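(* Let $n\ge 7$ be an integer. Then $$Ar(P_{n,3},C_6)=\begin{cases} 17, & \text{if } n=8;\\ 22, & \text{if } n=10;\\ 42, & \text{if } n=18;\\ \lfloor \frac{5n}{2} \rfloor, & \text{otherwise.} \end{cases}$$
   Context: For integers $n\ge 3$ and $1\le k\le \lfloor \frac{n-1}{2}\rfloor$, the generalized Petersen graph $P_{n,k}$ is the simple graph with vertex set $\{u_i,v_i : 0\leq i\leq n-1\}$ ($2n$ distinct vertices) and edge set $\{u_iu_{i+1},\,u_iv_i,\,v_iv_{i+k} : 0\leq i\leq n-1\}$, subscripts taken modulo $n$; it has $3n$ edges. $C_d$ denotes the cycle on $d$ vertices. An edge-coloring of a graph $G$ is an arbitrary map from $E(G)$ to a set of colors (not necessarily proper); the number of colors of the coloring is the number of colors actually used. A copy of $H$ in $G$ is a (not necessarily induced) subgraph of $G$ isomorphic to $H$; it is rainbow if its edges receive pairwise distinct colors. The anti-Ramsey number $Ar(G,H)$ is the maximum number of colors in an edge-coloring of $G$ which has no rainbow copy of $H$; if $G$ contains no copy of $H$, then $Ar(G,H)=|E(G)|$. *)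

theory Defs
  imports Main
begin

record 'a graph =
  verts :: "'a set"
  edges :: "'a set set"

definition simple_graph :: "'a graph \<Rightarrow> bool" where
  "simple_graph G \<longleftrightarrow> (\<forall>e\<in>edges G. e \<subseteq> verts G \<and> card e = 2)"

definition subgraph :: "'a graph \<Rightarrow> 'a graph \<Rightarrow> bool" where
  "subgraph S G \<longleftrightarrow> simple_graph S \<and> verts S \<subseteq> verts G \<and> edges S \<subseteq> edges G"

definition isomorphic :: "'a graph \<Rightarrow> 'b graph \<Rightarrow> bool" where
  "isomorphic G H \<longleftrightarrow>
     (\<exists>f. bij_betw f (verts G) (verts H) \<and>
          (\<forall>x\<in>verts G. \<forall>y\<in>verts G. {x, y} \<in> edges G \<longleftrightarrow> {f x, f y} \<in> edges H))"

definition is_copy :: "'b graph \<Rightarrow> 'a graph \<Rightarrow> 'a graph \<Rightarrow> bool" where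
  "is_copy H G S \<longleftrightarrow> subgraph S G \<and> isomorphic S H"

definition rainbow :: "('a set \<Rightarrow> 'c) \<Rightarrow> 'a graph \<Rightarrow> bool" where
  "rainbow c S \<longleftrightarrow> inj_on c (edges S)"

text \<open>
  Colors are natural numbers, which is no restriction for finite graphs. A coloring is a total
  function on sets of vertices, of which only the values on the edges of the graph matter.
  The maximum is meaningful for finite \<open>G\<close> and for \<open>H\<close> with at least two edges; see
  \<open>finite_color_numbers\<close> and \<open>color_numbers_nonempty\<close> below.
\<close>

definition color_numbers :: "'a graph \<Rightarrow> 'b graph \<Rightarrow> nat set" where
  "color_numbers G H =
     {card (c ` edges G) | c :: 'a set \<Rightarrow> nat. \<not> (\<exists>S. is_copy H G S \<and> rainbow c S)}"

definition anti_Ramsey :: "'a graph \<Rightarrow> 'b graph \<Rightarrow> nat" where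
  "anti_Ramsey G H = Max (color_numbers G H)"

text \<open>A genuine cycle only for \<open>d \<ge> 3\<close>.\<close>

definition cycle_graph :: "nat \<Rightarrow> nat graph" where
  "cycle_graph d =
     \<lparr>verts = {..<d},
      edges = {{i, (i + 1) mod d} | i. i < d}\<rparr>"

datatype petersen_vertex = U nat | V nat

text \<open>The intended range of the parameters is \<open>3 \<le> n\<close> and \<open>1 \<le> k \<le> (n - 1) div 2\<close>.\<close>

definition gen_petersen :: "nat \<Rightarrow> nat \<Rightarrow> petersen_vertex graph" where
  "gen_petersen n k =
     \<lparr>verts = U ` {..<n} \<union> V ` {..<n},
      edges = {{U i, U ((i + 1) mod n)} | i. i < n} \<union>
              {{U i, V i} | i. i < n} \<union>
              {{V i, V ((i + k) mod n)} | i. i < n}\<rparr>"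

lemma finite_color_numbers:
  assumes "finite (edges G)"
  shows "finite (color_numbers G H)"
proof (rule finite_subset)
  show "color_numbers G H \<subseteq> {..card (edges G)}"
    using assms by (auto simp: color_numbers_def card_image_le)
qed simp

lemma simple_graph_edgeE:
  assumes "simple_graph G" "e \<in> edges G"
  obtains a b where "e = {a, b}" "a \<in> verts G" "b \<in> verts G"
proof -
  have "e \<subseteq> verts G" "card e = 2"
    using assms by (simp_all add: simple_graph_def)
  moreover from this obtain a b where "e = {a, b}"
    by (metis card_2_iff)
  ultimately show thesis using that by simp
qed

lemma isomorphic_edges_image:
  assumes "simple_graph S" "simple_graph H" "bij_betw f (verts S) (verts H)"
    and iso: "\<forall>x\<in>verts S. \<forall>y\<in>verts S. {x, y} \<in> edges S \<longleftrightarrow> {f x, f y} \<in> edges H"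
  shows "edges H = image f ` edges S"
proof (intro equalityI subsetI)
  fix e assume e: "e \<in> edges H"
  then obtain a b where ab: "e = {a, b}" "a \<in> verts H" "b \<in> verts H"
    using assms(2) simple_graph_edgeE by metis
  moreover have "f ` verts S = verts H"
    using assms(3) by (rule bij_betw_imp_surj_on)
  ultimately obtain x y where xy: "x \<in> verts S" "y \<in> verts S" "f x = a" "f y = b"
    by (metis imageE)
  then have "{x, y} \<in> edges S" using iso ab(1) e by simp
  moreover have "e = f ` {x, y}" using ab(1) xy by simp
  ultimately show "e \<in> image f ` edges S" by (rule rev_image_eqI)
next
  fix e assume "e \<in> image f ` edges S"
  then obtain d where d: "d \<in> edges S" "e = f ` d" by (rule imageE)
  then obtain x y where "d = {x, y}" "x \<in> verts S" "y \<in> verts S"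
    using assms(1) simple_graph_edgeE by metis
  then show "e \<in> edges H" using iso d by simp
qed

lemma color_numbers_nonempty:
  fixes G :: "'a graph" and H :: "'b graph"
  assumes "simple_graph H" "\<exists>e\<in>edges H. \<exists>e'\<in>edges H. e \<noteq> e'"
  shows "color_numbers G H \<noteq> {}"
proof -
  have "\<not> (is_copy H G S \<and> rainbow (\<lambda>_. 0 :: nat) S)" for S :: "'a graph"
  proof
    assume S: "is_copy H G S \<and> rainbow (\<lambda>_. 0 :: nat) S"
    then have "simple_graph S" "isomorphic S H"
      by (simp_all add: is_copy_def subgraph_def)
    then obtain f where f: "edges H = image f ` edges S"
      using isomorphic_edges_image[OF _ assms(1)] unfolding isomorphic_def by metis
    have "d = d'" if "d \<in> edges S" "d' \<in> edges S" for d d'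
      using S that by (auto simp: rainbow_def inj_on_def)
    then show False using assms(2) unfolding f by blast
  qed
  then have "card ((\<lambda>_. 0 :: nat) ` edges G) \<in> color_numbers G H"
    unfolding color_numbers_def by (auto intro!: exI[of _ "\<lambda>_. 0 :: nat"])
  then show ?thesis by blast
qed

lemma anti_Ramsey_no_copy:
  assumes "finite (edges G)" "\<not> (\<exists>S. is_copy H G S)"
  shows "anti_Ramsey G H = card (edges G)"
  unfolding anti_Ramsey_def
proof (rule Max_eqI)
  show "finite (color_numbers G H)" using assms(1) by (rule finite_color_numbers)
  show "m \<le> card (edges G)" if "m \<in> color_numbers G H" for m
    using that assms(1) by (auto simp: color_numbers_def card_image_le)
  obtain c :: "'a set \<Rightarrow> nat" where "inj_on c (edges G)"
    using finite_imp_inj_to_nat_seg[OF assms(1)] by blast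
  then show "card (edges G) \<in> color_numbers G H"
    using assms(2) unfolding color_numbers_def by (auto simp: card_image intro!: exI[of _ c])
qed

lemma simple_graph_cycle_graph:
  assumes "d \<ge> 3"
  shows "simple_graph (cycle_graph d)"
proof -
  have "i \<noteq> (i + 1) mod d" if "i < d" for i
    using that assms by (cases "i + 1 < d") (auto simp: le_mod_geq)
  then show ?thesis
    using assms by (auto simp: simple_graph_def cycle_graph_def card_insert_if)
qed

lemma simple_graph_gen_petersen:
  assumes "n \<ge> 3" "1 \<le> k" "k \<le> (n - 1) div 2"
  shows "simple_graph (gen_petersen n k)"
proof -
  have shift: "(i + m) mod n \<noteq> i" if "i < n" "1 \<le> m" "m < n" for i m
    using that by (cases "i + m < n") (auto simp: le_mod_geq)
  have "k < n" using assms by linarith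
  then have "i \<noteq> (i + 1) mod n" "i \<noteq> (i + k) mod n" if "i < n" for i
    using shift[of i 1] shift[of i k] that assms by simp_all
  then show ?thesis
    using assms(1) by (auto simp: simple_graph_def gen_petersen_def card_insert_if)
qed

lemma card_verts_gen_petersen: "card (verts (gen_petersen n k)) = 2 * n"
proof -
  have "card (U ` {..<n} \<union> V ` {..<n}) = card (U ` {..<n}) + card (V ` {..<n})"
    by (rule card_Un_disjoint) auto
  then show ?thesis by (simp add: gen_petersen_def card_image inj_on_def)
qed

lemma card_edges_gen_petersen:
  assumes "n \<ge> 3" "1 \<le> k" "k \<le> (n - 1) div 2"
  shows "card (edges (gen_petersen n k)) = 3 * n"
proof -
  let ?a = "\<lambda>i. {U i, U ((i + 1) mod n)}"
  let ?b = "\<lambda>i. {U i, V i}"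
  let ?c = "\<lambda>i. {V i, V ((i + k) mod n)}"
  have mod: "(i + m) mod n = (if i + m < n then i + m else i + m - n)" if "i < n" "m < n" for i m
    using that by (auto simp: le_mod_geq)
  have *: False if "i < n" "j < n" "i \<noteq> j" "i = (j + m) mod n" "(i + m) mod n = j"
    "1 \<le> m" "2 * m < n" for i j m
  proof -
    have "j = (if i + m < n then i + m else i + m - n)"
      using that mod[of i m] by linarith
    moreover have "i = (if j + m < n then j + m else j + m - n)"
      using that mod[of j m] by linarith
    ultimately show False
      using that(1,2,6,7) by (simp only: split: if_splits; linarith)
  qed
  have k: "2 * k < n" using assms by linarith
  have a: "inj_on ?a {..<n}"
  proof (rule inj_onI)
    fix i j assume ij: "i \<in> {..<n}" "j \<in> {..<n}" and "?a i = ?a j"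
    then have "i = j \<or> i = (j + 1) mod n \<and> (i + 1) mod n = j"
      unfolding doubleton_eq_iff petersen_vertex.inject by blast
    moreover have "1 \<le> (1 :: nat)" "2 * 1 < n" using assms(1,2) k by linarith+
    ultimately show "i = j"
      using *[of i j 1] ij unfolding lessThan_iff by blast
  qed
  have b: "inj_on ?b {..<n}" by (auto simp: inj_on_def doubleton_eq_iff)
  have c: "inj_on ?c {..<n}"
  proof (rule inj_onI)
    fix i j assume ij: "i \<in> {..<n}" "j \<in> {..<n}" and "?c i = ?c j"
    then have "i = j \<or> i = (j + k) mod n \<and> (i + k) mod n = j"
      unfolding doubleton_eq_iff petersen_vertex.inject by blast
    moreover have "1 \<le> k" "2 * k < n" using assms(1,2) k by linarith+
    ultimately show "i = j"
      using *[of i j k] ij unfolding lessThan_iff by blast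
  qed
  have E: "edges (gen_petersen n k) = ?a ` {..<n} \<union> ?b ` {..<n} \<union> ?c ` {..<n}"
    unfolding gen_petersen_def by auto
  have ab: "?a ` {..<n} \<inter> ?b ` {..<n} = {}" by (auto simp: doubleton_eq_iff)
  have abc: "(?a ` {..<n} \<union> ?b ` {..<n}) \<inter> ?c ` {..<n} = {}" by (auto simp: doubleton_eq_iff)
  have "card (edges (gen_petersen n k)) =
        card (?a ` {..<n}) + card (?b ` {..<n}) + card (?c ` {..<n})"
    unfolding E using ab abc by (simp only: card_Un_disjoint finite_imageI finite_lessThan finite_UnI)
  then show ?thesis by (simp only: card_image[OF a] card_image[OF b] card_image[OF c] card_lessThan)
qed

end

theory Submission
  imports Defs "HOL-Library.Code_Binary_Nat"
begin

text \<open>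
  Call a 6-cycle of \<open>P\<^bsub>n,3\<^esub>\<close> a hexagon, and let the deficit of an edge coloring be \<open>3n\<close> minus its number
  of colors, that is, the sum of \<open>|T| - 1\<close> over the color classes \<open>T\<close>.  A hexagon is not rainbow iff
  some class hits it, which means that it contains two edges of that class.  So the question is how small
  the deficit can be when every hexagon is hit, and everything depends on how many hexagons one class
  can hit compared with its cost \<open>|T| - 1\<close>.

  Every \<open>P\<^bsub>n,3\<^esub>\<close> has the \<open>n\<close> standard hexagons \<open>u\<^sub>i u\<^sub>i\<^sub>+\<^sub>1 u\<^sub>i\<^sub>+\<^sub>2 u\<^sub>i\<^sub>+\<^sub>3 v\<^sub>i\<^sub>+\<^sub>3 v\<^sub>i\<close>.  A walk around a
  hexagon moves the subscript by \<open>\<plusminus>1\<close> or \<open>\<plusminus>3\<close> at a time, so any other hexagon forces a small multiple of \<open>n\<close>;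
  this leaves two more families for \<open>n = 8\<close>, one more for \<open>n = 10\<close>, and the inner hexagons for \<open>n = 18\<close>
  (\<open>hexagons_eq\<close>).

  An edge lies on at most three standard hexagons and two edges lie together on at most two.  Counting
  incidences, a class of size \<open>m \<ge> 3\<close> hits at most \<open>\<lfloor>3m/2\<rfloor> \<le> 2(m - 1)\<close> of them, and a class of size two
  hits at most \<open>2 = 2(m - 1)\<close>.  Hence \<open>n\<close> is at most twice the deficit (\<open>color_bound_generic\<close>).  Giving
  consecutive pairs of outer edges a common color attains this bound.  For \<open>n = 18\<close> the same count works
  after each inner hexagon is counted twice: \<open>18 + 2 \<cdot> 3 = 24\<close>, so the deficit is at least 12.

  For \<open>n = 8\<close> and \<open>n = 10\<close> every edge lies on \<open>2d\<close> hexagons and two edges lie together on at most \<open>d\<close>, where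
  \<open>d = 3\<close> and \<open>d = 2\<close>.  There are \<open>8d\<close> resp. \<open>10d\<close> hexagons.  Now a class of size \<open>m \<ge> 3\<close> may hit \<open>d m\<close> of
  them, for instance the three edges at a vertex, and this excess \<open>d\<close> of large classes is why plain
  counting falls short of the truth by one.  If the deficit were smaller than claimed, the count would
  require at least two (\<open>n = 8\<close>) or three (\<open>n = 10\<close>) large classes and would have almost no slack.
  When there is no slack, an edge of one large class shares no hexagon with an edge of another
  (\<open>large_classes_tight\<close>).  Two properties of the relation ``the two edges share no hexagon'', verified by
  evaluation, limit this: for \<open>n = 10\<close> it contains no \<open>K\<^bsub>2,2,2\<^esub>\<close>, which is a contradiction, and for \<open>n = 8\<close> it
  contains no \<open>K\<^bsub>2,4\<^esub>\<close>, which bounds the sizes of the large classes.  For \<open>n = 8\<close> there remain colorings in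
  which two classes of three edges each hit at least eight hexagons; the hexagons missed by both are then too spread out to be hit by the remaining
  classes at cost two (\<open>residual_contradiction\<close>).
\<close>

section \<open>Copies of a cycle as closed walks\<close>

text \<open>
  Copies of \<open>C\<^sub>d\<close> are handled through injective closed walks; the isomorphism with the cycle graph is
  then the enumeration of the vertices.
\<close>

definition closed_walk_edges :: "nat \<Rightarrow> (nat \<Rightarrow> 'a) \<Rightarrow> 'a set set" where
  "closed_walk_edges d w = (\<lambda>i. {w i, w ((i + 1) mod d)}) ` {..<d}"

lemma closed_walk_edges_conv: "closed_walk_edges d w = image w ` edges (cycle_graph d)"
  by (auto simp: closed_walk_edges_def cycle_graph_def image_def)

lemma copy_imp_closed_walk:
  assumes d: "d \<ge> 3" and S: "is_copy (cycle_graph d) G S"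
  obtains w where "inj_on w {..<d}" "edges S = closed_walk_edges d w" "edges S \<subseteq> edges G"
proof -
  have sg: "simple_graph S" "edges S \<subseteq> edges G" and "isomorphic S (cycle_graph d)"
    using S by (auto simp: is_copy_def subgraph_def)
  then obtain f where f: "bij_betw f (verts S) (verts (cycle_graph d))"
    and iso: "\<forall>x\<in>verts S. \<forall>y\<in>verts S. {x, y} \<in> edges S \<longleftrightarrow> {f x, f y} \<in> edges (cycle_graph d)"
    unfolding isomorphic_def by blast
  have E: "edges (cycle_graph d) = image f ` edges S"
    by (rule isomorphic_edges_image[OF sg(1) simple_graph_cycle_graph[OF d] f iso])
  let ?w = "inv_into (verts S) f"
  have "?w ` f ` e = e" if "e \<in> edges S" for e
    using that sg(1) f by (auto simp: simple_graph_def bij_betw_def inv_into_image_cancel)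
  then have "edges S = image ?w ` edges (cycle_graph d)"
    unfolding E by (simp add: image_image)
  moreover have "inj_on ?w {..<d}"
    using bij_betw_inv_into[OF f] by (simp add: bij_betw_def cycle_graph_def)
  ultimately show thesis
    using sg(2) that by (simp add: closed_walk_edges_conv)
qed

lemma closed_walk_imp_copy:
  assumes d: "d \<ge> 3" and G: "simple_graph G" and w: "inj_on w {..<d}"
    and sub: "closed_walk_edges d w \<subseteq> edges G"
  obtains S where "is_copy (cycle_graph d) G S" "edges S = closed_walk_edges d w"
proof
  let ?S = "\<lparr>verts = w ` {..<d}, edges = closed_walk_edges d w\<rparr>"
  let ?f = "inv_into {..<d} w"
  have H: "e \<subseteq> {..<d}" if "e \<in> edges (cycle_graph d)" for e
    using that simple_graph_cycle_graph[OF d] by (auto simp: simple_graph_def cycle_graph_def)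
  have "isomorphic ?S (cycle_graph d)"
    unfolding isomorphic_def
  proof (intro exI[of _ ?f] conjI ballI)
    show "bij_betw ?f (verts ?S) (verts (cycle_graph d))"
      using w by (simp add: cycle_graph_def bij_betw_inv_into inj_on_imp_bij_betw)
    fix x y assume "x \<in> verts ?S" "y \<in> verts ?S"
    then obtain i j where ij: "i < d" "j < d" "x = w i" "y = w j" by auto
    have f: "?f x = i" "?f y = j" using ij w by auto
    have "{x, y} \<in> edges ?S \<longleftrightarrow> w ` {i, j} \<in> image w ` edges (cycle_graph d)"
      using ij by (simp add: closed_walk_edges_conv)
    also have "\<dots> \<longleftrightarrow> {i, j} \<in> edges (cycle_graph d)"
    proof
      assume "w ` {i, j} \<in> image w ` edges (cycle_graph d)"
      then obtain e where e: "e \<in> edges (cycle_graph d)" "w ` {i, j} = w ` e" by blast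
      have "{i, j} = e"
        using inj_on_image_eq_iff[OF w, of "{i, j}" e] e H[OF e(1)] ij(1,2) by auto
      then show "{i, j} \<in> edges (cycle_graph d)" using e(1) by simp
    qed blast
    finally show "{x, y} \<in> edges ?S \<longleftrightarrow> {?f x, ?f y} \<in> edges (cycle_graph d)"
      by (simp add: f)
  qed
  moreover have "closed_walk_edges d w \<subseteq> Pow (w ` {..<d})"
    unfolding closed_walk_edges_conv using H by blast
  moreover have "card e = 2" if "e \<in> closed_walk_edges d w" for e
    using that sub G by (auto simp: simple_graph_def)
  moreover have "w i \<in> verts G" if "i < d" for i
  proof -
    have "{w i, w ((i + 1) mod d)} \<in> edges G"
      using sub that unfolding closed_walk_edges_def by blast
    then show ?thesis using G by (auto simp: simple_graph_def)
  qed
  ultimately show "is_copy (cycle_graph d) G ?S"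
    using sub by (auto simp: is_copy_def subgraph_def simple_graph_def)
qed simp

text \<open>
  The starting point of a closed walk can be moved, which later allows a hexagon to be traversed from
  a convenient vertex.
\<close>

lemma rotate_image:
  assumes "d > 0"
  shows "(\<lambda>i. (i + k) mod d) ` {..<d} = {..<d :: nat}"
proof -
  have "j \<in> (\<lambda>i. (i + k) mod d) ` {..<d}" if "j < d" for j
  proof (rule image_eqI)
    have "((j + (d - k mod d)) mod d + k) mod d = (j + (d - k mod d) + k mod d) mod d"
      by (simp add: mod_simps)
    also have "j + (d - k mod d) + k mod d = j + d" using mod_less_divisor[OF assms, of k] by linarith
    finally show "j = ((j + (d - k mod d)) mod d + k) mod d" using that by simp
  qed (use assms in simp)
  then show ?thesis using assms by auto
qed

lemma inj_on_rotate:
  fixes d :: nat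
  assumes "d > 0" "inj_on w {..<d}"
  shows "inj_on (\<lambda>i. w ((i + k) mod d)) {..<d}"
proof -
  have "inj_on (\<lambda>i. (i + k) mod d) {..<d}"
    by (rule eq_card_imp_inj_on) (simp_all add: rotate_image[OF assms(1)])
  then show ?thesis
    using comp_inj_on[of "\<lambda>i. (i + k) mod d" "{..<d}" w] rotate_image[OF assms(1)] assms(2)
    by (simp add: comp_def)
qed

lemma closed_walk_edges_rotate:
  assumes "d > 0"
  shows "closed_walk_edges d (\<lambda>i. w ((i + k) mod d)) = closed_walk_edges d w"
proof -
  have "closed_walk_edges d (\<lambda>i. w ((i + k) mod d))
      = (\<lambda>i. {w i, w ((i + 1) mod d)}) ` (\<lambda>i. (i + k) mod d) ` {..<d}"
    unfolding closed_walk_edges_def image_image by (intro image_cong) (simp_all add: mod_simps ac_simps)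
  then show ?thesis by (simp add: rotate_image[OF assms] closed_walk_edges_def)
qed

section \<open>Numbering the edges\<close>

text \<open>
  Edges are numbered in three blocks of length \<open>n\<close>: outer edges, spokes, inner edges.  A hexagon is then
  a set of six numbers, and these sets can be computed with.
\<close>

definition edge_of :: "nat \<Rightarrow> nat \<Rightarrow> petersen_vertex set" where
  "edge_of n e =
     (if e < n then {U e, U ((e + 1) mod n)}
      else if e < 2 * n then {U (e - n), V (e - n)}
      else {V (e - 2 * n), V ((e - 2 * n + 3) mod n)})"

lemma edges_gen_petersen_edge_of: "edges (gen_petersen n 3) = edge_of n ` {..<3 * n}"
proof -
  have "{..<3 * n} \<subseteq> {..<n} \<union> (+) n ` {..<n} \<union> (+) (2 * n) ` {..<n}"
  proof
    fix e assume "e \<in> {..<3 * n}"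
    then consider "e < n" | "e - n < n" "e = n + (e - n)" | "e - 2 * n < n" "e = 2 * n + (e - 2 * n)"
      by fastforce
    then show "e \<in> {..<n} \<union> (+) n ` {..<n} \<union> (+) (2 * n) ` {..<n}"
      by cases blast+
  qed
  then have "{..<3 * n} = {..<n} \<union> (+) n ` {..<n} \<union> (+) (2 * n) ` {..<n}" by auto
  moreover have "edge_of n ` {..<n} = (\<lambda>i. {U i, U ((i + 1) mod n)}) ` {..<n}"
    "edge_of n ` (+) n ` {..<n} = (\<lambda>i. {U i, V i}) ` {..<n}"
    "edge_of n ` (+) (2 * n) ` {..<n} = (\<lambda>i. {V i, V ((i + 3) mod n)}) ` {..<n}"
    unfolding image_image by (auto intro!: image_cong simp: edge_of_def)
  ultimately have "edge_of n ` {..<3 * n} = (\<lambda>i. {U i, U ((i + 1) mod n)}) ` {..<n} \<union>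
      (\<lambda>i. {U i, V i}) ` {..<n} \<union> (\<lambda>i. {V i, V ((i + 3) mod n)}) ` {..<n}"
    by (simp only: image_Un)
  then show ?thesis by (simp only: gen_petersen_def graph.simps setcompr_eq_image lessThan_def)
qed

lemma inj_on_edge_of:
  assumes "n \<ge> 7"
  shows "inj_on (edge_of n) {..<3 * n}"
  by (rule eq_card_imp_inj_on)
     (use assms card_edges_gen_petersen[of n 3] in \<open>simp_all add: edges_gen_petersen_edge_of\<close>)

text \<open>
  The hexagons of \<open>P\<^bsub>n,3\<^esub>\<close> as sets of edge numbers.
\<close>

definition hexagons :: "nat \<Rightarrow> nat set set" where
  "hexagons n = {D. D \<subseteq> {..<3 * n} \<and>
     (\<exists>w. inj_on w {..<6} \<and> edge_of n ` D = closed_walk_edges 6 w)}"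

text \<open>
  Only the edge set of a copy matters for being rainbow, so colorings of edges can be replaced by
  colorings of edge numbers, along the bijection \<open>edge_of n\<close>.
\<close>

lemma color_numbers_gen_petersen:
  assumes n: "n \<ge> 7"
  shows "color_numbers (gen_petersen n 3) (cycle_graph 6) =
    {card (c ` {..<3 * n}) | c :: nat \<Rightarrow> nat. \<forall>D\<in>hexagons n. \<not> inj_on c D}"
    (is "_ = ?R")
proof (intro equalityI subsetI)
  let ?G = "gen_petersen n 3"
  have G: "simple_graph ?G" using n by (intro simple_graph_gen_petersen) auto
  {
    fix k assume "k \<in> color_numbers ?G (cycle_graph 6)"
    then obtain c :: "petersen_vertex set \<Rightarrow> nat" where k: "k = card (c ` edges ?G)"
      and c: "\<not> (\<exists>S. is_copy (cycle_graph 6) ?G S \<and> rainbow c S)"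
      unfolding color_numbers_def by blast
    have "\<not> inj_on (c \<circ> edge_of n) D" if D: "D \<in> hexagons n" for D
    proof
      assume inj: "inj_on (c \<circ> edge_of n) D"
      obtain w where w: "inj_on w {..<6}" "edge_of n ` D = closed_walk_edges 6 w"
        and "D \<subseteq> {..<3 * n}"
        using D unfolding hexagons_def by blast
      then have "closed_walk_edges 6 w \<subseteq> edges ?G"
        unfolding edges_gen_petersen_edge_of by blast
      then obtain S where "is_copy (cycle_graph 6) ?G S" "edges S = edge_of n ` D"
        using closed_walk_imp_copy[OF _ G w(1)] w(2) by force
      moreover have "inj_on c (edge_of n ` D)" using inj by (rule inj_on_imageI)
      ultimately show False using c unfolding rainbow_def by metis
    qed
    moreover have "k = card ((c \<circ> edge_of n) ` {..<3 * n})"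
      by (simp add: k edges_gen_petersen_edge_of image_comp)
    ultimately show "k \<in> ?R" by blast
  next
    fix k assume "k \<in> ?R"
    then obtain c :: "nat \<Rightarrow> nat" where k: "k = card (c ` {..<3 * n})"
      and c: "\<And>D. D \<in> hexagons n \<Longrightarrow> \<not> inj_on c D" by blast
    let ?inv = "inv_into {..<3 * n} (edge_of n)"
    have inv: "?inv (edge_of n e) = e" if "e < 3 * n" for e
      using inj_on_edge_of[OF n] that by simp
    have "\<not> rainbow (c \<circ> ?inv) S" if S: "is_copy (cycle_graph 6) ?G S" for S
    proof
      assume "rainbow (c \<circ> ?inv) S"
      then have inj: "inj_on (c \<circ> ?inv) (edges S)" by (simp add: rainbow_def)
      obtain w where w: "inj_on w {..<6}" "edges S = closed_walk_edges 6 w" "edges S \<subseteq> edges ?G"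
        using copy_imp_closed_walk[OF _ S] by force
      define D where "D = {e \<in> {..<3 * n}. edge_of n e \<in> edges S}"
      have D: "edge_of n ` D = edges S"
        using w(3) unfolding D_def edges_gen_petersen_edge_of by blast
      then have "D \<in> hexagons n"
        using w(1,2) unfolding hexagons_def D_def by auto
      moreover have "inj_on c D"
      proof (rule inj_onI)
        fix x y assume xy: "x \<in> D" "y \<in> D" "c x = c y"
        then have "edge_of n x \<in> edges S" "edge_of n y \<in> edges S" "x < 3 * n" "y < 3 * n"
          by (auto simp: D_def)
        then show "x = y" using inj_onD[OF inj, of "edge_of n x" "edge_of n y"] xy(3) inv
          by (metis comp_apply)
      qed
      ultimately show False using c by blast
    qed
    moreover have "k = card ((c \<circ> ?inv) ` edges ?G)"
      unfolding k edges_gen_petersen_edge_of image_image comp_def using inv by simp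
    ultimately show "k \<in> color_numbers ?G (cycle_graph 6)"
      unfolding color_numbers_def by blast
  }
qed


section \<open>The hexagons\<close>

text \<open>
  Vertices and edge numbers with arbitrary integer subscripts, read modulo \<open>n\<close>.  This makes subscripts
  like \<open>x - 3\<close> meaningful and turns equality of vertices into divisibility by \<open>n\<close>.
\<close>

definition uu :: "nat \<Rightarrow> int \<Rightarrow> petersen_vertex" where "uu n x = U (nat (x mod int n))"
definition vv :: "nat \<Rightarrow> int \<Rightarrow> petersen_vertex" where "vv n x = V (nat (x mod int n))"

definition outer :: "nat \<Rightarrow> int \<Rightarrow> nat" where "outer n x = nat (x mod int n)"
definition spoke :: "nat \<Rightarrow> int \<Rightarrow> nat" where "spoke n x = n + nat (x mod int n)"
definition inner :: "nat \<Rightarrow> int \<Rightarrow> nat" where "inner n x = 2 * n + nat (x mod int n)"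

lemma nat_mod_eq_iff_dvd:
  assumes "n > 0"
  shows "nat (x mod int n) = nat (y mod int n) \<longleftrightarrow> int n dvd x - y"
  using assms by (simp add: eq_nat_nat_iff mod_eq_dvd_iff)

lemma uu_eq_iff: "n > 0 \<Longrightarrow> uu n x = uu n y \<longleftrightarrow> int n dvd x - y"
  and vv_eq_iff: "n > 0 \<Longrightarrow> vv n x = vv n y \<longleftrightarrow> int n dvd x - y"
  and uu_neq_vv: "uu n x \<noteq> vv n y" "vv n y \<noteq> uu n x"
  by (simp_all add: uu_def vv_def nat_mod_eq_iff_dvd)

lemma edge_of_residue:
  assumes "n > 0"
  shows "edge_of n (outer n x) = {uu n x, uu n (x + 1)}"
    and "edge_of n (spoke n x) = {uu n x, vv n x}"
    and "edge_of n (inner n x) = {vv n x, vv n (x + 3)}"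
proof -
  have lt: "nat (x mod int n) < n" using assms by (simp add: nat_less_iff)
  have "int ((nat (x mod int n) + m) mod n) = (x + int m) mod int n" for m
    using assms by (simp add: of_nat_mod mod_simps)
  then have "(nat (x mod int n) + m) mod n = nat ((x + int m) mod int n)" for m
    by (metis nat_int)
  from this[of 1] this[of 3] lt
  show "edge_of n (outer n x) = {uu n x, uu n (x + 1)}"
    and "edge_of n (spoke n x) = {uu n x, vv n x}"
    and "edge_of n (inner n x) = {vv n x, vv n (x + 3)}"
    by (simp_all add: edge_of_def outer_def spoke_def inner_def uu_def vv_def)
qed

lemma edge_of_residueE:
  assumes "n > 0" "e < 3 * n"
  obtains x where "edge_of n e = {uu n x, uu n (x + 1)}"
    | x where "edge_of n e = {uu n x, vv n x}"
    | x where "edge_of n e = {vv n x, vv n (x + 3)}"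
proof -
  consider "e < n" | "n \<le> e" "e < 2 * n" | "2 * n \<le> e" by linarith
  then show thesis
  proof cases
    case 1
    then have "e = outer n (int e)" by (simp add: outer_def)
    then show thesis using that(1) edge_of_residue(1)[OF assms(1)] by metis
  next
    case 2
    then have "nat (int (e - n) mod int n) = e - n"
      by (metis less_diff_conv2 mod_less mult_2 nat_int zmod_int)
    then have "e = spoke n (int (e - n))" unfolding spoke_def using 2 by linarith
    then show thesis using that(2) edge_of_residue(2)[OF assms(1)] by metis
  next
    case 3
    then have "e = inner n (int (e - 2 * n))" using assms(2) by (simp add: inner_def)
    then show thesis using that(3) edge_of_residue(3)[OF assms(1)] by metis
  qed
qed

lemma edge_of_uuD:
  assumes "n > 0" "e < 3 * n" "edge_of n e = {uu n x, q}"
  shows "q = uu n (x + 1) \<or> q = uu n (x - 1) \<or> q = vv n x"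
  using assms(1,2)
proof (cases rule: edge_of_residueE)
  case (1 y)
  then consider "uu n x = uu n y" "q = uu n (y + 1)" | "uu n x = uu n (y + 1)" "q = uu n y"
    using assms(3) by (auto simp: doubleton_eq_iff)
  then show ?thesis
    by cases (use assms(1) in \<open>auto simp: uu_eq_iff algebra_simps\<close>)
next
  case (2 y)
  then show ?thesis using assms(1,3)
    by (auto simp: doubleton_eq_iff uu_neq_vv uu_eq_iff vv_eq_iff dvd_diff_commute)
next
  case (3 y)
  then show ?thesis using assms(3) by (auto simp: doubleton_eq_iff uu_neq_vv)
qed

lemma edge_of_vvD:
  assumes "n > 0" "e < 3 * n" "edge_of n e = {vv n x, q}"
  shows "q = vv n (x + 3) \<or> q = vv n (x - 3) \<or> q = uu n x"
  using assms(1,2)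
proof (cases rule: edge_of_residueE)
  case (1 y)
  then show ?thesis using assms(3) by (auto simp: doubleton_eq_iff uu_neq_vv)
next
  case (2 y)
  then show ?thesis using assms(1,3)
    by (auto simp: doubleton_eq_iff uu_neq_vv uu_eq_iff vv_eq_iff dvd_diff_commute)
next
  case (3 y)
  then consider "vv n x = vv n y" "q = vv n (y + 3)" | "vv n x = vv n (y + 3)" "q = vv n y"
    using assms(3) by (auto simp: doubleton_eq_iff)
  then show ?thesis
    by cases (use assms(1) in \<open>auto simp: vv_eq_iff algebra_simps\<close>)
qed

text \<open>
  The families of hexagons, described by an outer path and an inner path joined by two spokes.  The
  standard one has three outer edges and one inner edge.  In the families 13 there are one outer and
  three inner edges: the inner path climbs by \<open>9\<close>, either from \<open>v\<^sub>x\<close> to \<open>v\<^sub>x\<^sub>+\<^sub>1\<close> (forward, \<open>9 \<equiv> 1\<close> modulo \<open>8\<close>)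
  or from \<open>v\<^sub>x\<^sub>+\<^sub>1\<close> to \<open>v\<^sub>x\<close> (backward, \<open>9 \<equiv> -1\<close> modulo \<open>10\<close>).  In the family 22 there are two of each, and
  the inner path climbs by \<open>6 \<equiv> -2\<close> modulo \<open>8\<close>.
\<close>

definition hex_std where
  "hex_std n x = {outer n x, outer n (x + 1), outer n (x + 2), spoke n x, spoke n (x + 3), inner n x}"
definition hex_13_forward where
  "hex_13_forward n x = {outer n x, spoke n x, spoke n (x + 1), inner n x, inner n (x + 3), inner n (x + 6)}"
definition hex_22 where
  "hex_22 n x = {outer n x, outer n (x + 1), spoke n x, spoke n (x + 2), inner n (x + 2), inner n (x + 5)}"
definition hex_13_backward where
  "hex_13_backward n x = {outer n x, spoke n x, spoke n (x + 1), inner n (x + 1), inner n (x + 4), inner n (x + 7)}"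
definition hex_inner where
  "hex_inner n x = {inner n x, inner n (x + 3), inner n (x + 6), inner n (x + 9), inner n (x + 12), inner n (x + 15)}"

definition is_hexagon :: "nat \<Rightarrow> nat set \<Rightarrow> bool" where
  "is_hexagon n D \<longleftrightarrow> (\<exists>x. D = hex_std n x \<or>
     n = 8 \<and> (D = hex_13_forward n x \<or> D = hex_22 n x) \<or>
     n = 10 \<and> D = hex_13_backward n x \<or>
     n = 18 \<and> D = hex_inner n x)"

definition hexagon_edges :: "'a \<Rightarrow> 'a \<Rightarrow> 'a \<Rightarrow> 'a \<Rightarrow> 'a \<Rightarrow> 'a \<Rightarrow> 'a set set" where
  "hexagon_edges a b c d e f = {{a, b}, {b, c}, {c, d}, {d, e}, {e, f}, {f, a}}"

lemma closed_walk_edges_6: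
  "closed_walk_edges 6 w = hexagon_edges (w 0) (w 1) (w 2) (w 3) (w 4) (w 5)"
proof -
  have "{..<6} = {0, 1, 2, 3, 4, 5 :: nat}" by auto
  then show ?thesis by (simp add: closed_walk_edges_def hexagon_edges_def flip: numeral_2_eq_2)
qed

lemma inj_on_6: "inj_on w {..<6 :: nat} \<longleftrightarrow> distinct [w 0, w 1, w 2, w 3, w 4, w 5]"
proof -
  have "{..<6} = set [0, 1, 2, 3, 4, 5 :: nat]" by auto
  moreover have "distinct [0, 1, 2, 3, 4, 5 :: nat]" by simp
  ultimately show ?thesis
    using distinct_map[of w "[0, 1, 2, 3, 4, 5]"] by (simp only: list.map simp_thms)
qed

lemma hex_subset_edges:
  assumes "n > 0"
  shows "hex_std n x \<subseteq> {..<3 * n}" "hex_13_forward n x \<subseteq> {..<3 * n}" "hex_22 n x \<subseteq> {..<3 * n}"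
    "hex_13_backward n x \<subseteq> {..<3 * n}" "hex_inner n x \<subseteq> {..<3 * n}"
proof -
  have "nat (y mod int n) < n" for y using assms by (simp add: nat_less_iff)
  then have "outer n y < 3 * n" "spoke n y < 3 * n" "inner n y < 3 * n" for y
    by (simp_all add: outer_def spoke_def inner_def add_strict_mono mult_2 numeral_3_eq_3 trans_less_add1)
  then show "hex_std n x \<subseteq> {..<3 * n}" "hex_13_forward n x \<subseteq> {..<3 * n}" "hex_22 n x \<subseteq> {..<3 * n}"
    "hex_13_backward n x \<subseteq> {..<3 * n}" "hex_inner n x \<subseteq> {..<3 * n}"
    by (simp_all add: hex_std_def hex_13_forward_def hex_22_def hex_13_backward_def hex_inner_def)
qed

lemma edge_of_hex_std:
  assumes "n > 0"
  shows "edge_of n ` hex_std n x =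
    hexagon_edges (uu n x) (uu n (x + 1)) (uu n (x + 2)) (uu n (x + 3)) (vv n (x + 3)) (vv n x)"
  using assms by (auto simp: hex_std_def hexagon_edges_def edge_of_residue add.assoc insert_commute)

lemma edge_of_hex_13_forward:
  "edge_of 8 ` hex_13_forward 8 x =
    hexagon_edges (uu 8 x) (uu 8 (x + 1)) (vv 8 (x + 1)) (vv 8 (x + 6)) (vv 8 (x + 3)) (vv 8 x)"
proof -
  have "vv 8 (x + 9) = vv 8 (x + 1)" by (simp add: vv_eq_iff)
  then show ?thesis by (auto simp: hex_13_forward_def hexagon_edges_def edge_of_residue add.assoc insert_commute)
qed

lemma edge_of_hex_22:
  "edge_of 8 ` hex_22 8 x =
    hexagon_edges (uu 8 x) (uu 8 (x + 1)) (uu 8 (x + 2)) (vv 8 (x + 2)) (vv 8 (x + 5)) (vv 8 x)"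
proof -
  have "vv 8 (x + 8) = vv 8 x" by (simp add: vv_eq_iff)
  then show ?thesis by (auto simp: hex_22_def hexagon_edges_def edge_of_residue add.assoc insert_commute)
qed

lemma edge_of_hex_13_backward:
  "edge_of 10 ` hex_13_backward 10 x =
    hexagon_edges (uu 10 x) (uu 10 (x + 1)) (vv 10 (x + 1)) (vv 10 (x + 4)) (vv 10 (x + 7)) (vv 10 x)"
proof -
  have "vv 10 (x + 10) = vv 10 x" by (simp add: vv_eq_iff)
  then show ?thesis by (auto simp: hex_13_backward_def hexagon_edges_def edge_of_residue add.assoc insert_commute)
qed

lemma edge_of_hex_inner:
  "edge_of 18 ` hex_inner 18 x =
    hexagon_edges (vv 18 x) (vv 18 (x + 3)) (vv 18 (x + 6)) (vv 18 (x + 9)) (vv 18 (x + 12)) (vv 18 (x + 15))"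
proof -
  have "vv 18 (x + 18) = vv 18 x" by (simp add: vv_eq_iff)
  then show ?thesis by (auto simp: hex_inner_def hexagon_edges_def edge_of_residue add.assoc insert_commute)
qed

lemma is_hexagon_imp_hexagons:
  assumes n: "n \<ge> 7" and D: "is_hexagon n D"
  shows "D \<in> hexagons n"
proof -
  have *: "D \<in> hexagons n"
    if "D \<subseteq> {..<3 * n}" "edge_of n ` D = hexagon_edges a b c d e f" "distinct [a, b, c, d, e, f]" for a b c d e f
    using that inj_on_6[of "(!) [a, b, c, d, e, f]"] closed_walk_edges_6[of "(!) [a, b, c, d, e, f]"]
    unfolding hexagons_def by (auto simp: numeral_eq_Suc)
  have nd: "\<not> int n dvd k" if "\<bar>k\<bar> < 7" "k \<noteq> 0" for k
    using that n zdvd_imp_le[of "int n" "\<bar>k\<bar>"] by auto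
  obtain x where "D = hex_std n x \<or> n = 8 \<and> (D = hex_13_forward n x \<or> D = hex_22 n x) \<or>
     n = 10 \<and> D = hex_13_backward n x \<or> n = 18 \<and> D = hex_inner n x"
    using D unfolding is_hexagon_def by blast
  then consider "D = hex_std n x" | "n = 8" "D = hex_13_forward n x" | "n = 8" "D = hex_22 n x"
    | "n = 10" "D = hex_13_backward n x" | "n = 18" "D = hex_inner n x" by blast
  then show ?thesis
  proof cases
    case 1
    show ?thesis
      by (rule *[OF _ edge_of_hex_std[of n x, folded 1]])
        (use n nd hex_subset_edges[of n x] in \<open>auto simp: 1 uu_eq_iff vv_eq_iff uu_neq_vv\<close>)
  next
    case 2
    show ?thesis
      by (rule *[OF _ edge_of_hex_13_forward[of x, folded 2]])
        (use hex_subset_edges[of n x] in \<open>auto simp: 2 uu_eq_iff vv_eq_iff uu_neq_vv\<close>)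
  next
    case 3
    show ?thesis
      by (rule *[OF _ edge_of_hex_22[of x, folded 3]])
        (use hex_subset_edges[of n x] in \<open>auto simp: 3 uu_eq_iff vv_eq_iff uu_neq_vv\<close>)
  next
    case 4
    show ?thesis
      by (rule *[OF _ edge_of_hex_13_backward[of x, folded 4]])
        (use hex_subset_edges[of n x] in \<open>auto simp: 4 uu_eq_iff vv_eq_iff uu_neq_vv\<close>)
  next
    case 5
    show ?thesis
      by (rule *[OF _ edge_of_hex_inner[of x, folded 5]])
        (use hex_subset_edges[of n x] in \<open>auto simp: 5 uu_eq_iff vv_eq_iff uu_neq_vv\<close>)
  qed
qed

definition adj :: "nat \<Rightarrow> petersen_vertex \<Rightarrow> petersen_vertex \<Rightarrow> bool" where
  "adj n p q \<longleftrightarrow> (\<exists>e<3 * n. edge_of n e = {p, q})"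

lemma adj_sym: "adj n p q \<Longrightarrow> adj n q p"
  by (simp add: adj_def insert_commute)

lemma adj_uuD:
  assumes "n > 0" "adj n (uu n x) q"
  shows "q = uu n (x + 1) \<or> q = uu n (x - 1) \<or> q = vv n x"
  using assms edge_of_uuD unfolding adj_def by blast

lemma adj_vvD:
  assumes "n > 0" "adj n (vv n x) q"
  shows "q = vv n (x + 3) \<or> q = vv n (x - 3) \<or> q = uu n x"
  using assms edge_of_vvD unfolding adj_def by blast

lemma not_dvd_small: "n \<ge> 7 \<Longrightarrow> \<bar>k\<bar> < 7 \<Longrightarrow> k \<noteq> 0 \<Longrightarrow> \<not> int n dvd k"
  using zdvd_imp_le[of "int n" "\<bar>k\<bar>"] by auto

text \<open>
  The only coincidences of subscripts that produce hexagons outside the standard family come from \<open>n\<close>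
  dividing \<open>8\<close>, \<open>10\<close> or \<open>18\<close>.
\<close>

lemma dvd_8: "n \<ge> 7 \<Longrightarrow> int n dvd 8 \<Longrightarrow> n = 8"
proof -
  assume n: "n \<ge> 7" "int n dvd 8"
  then have "int n \<le> 8" by (intro zdvd_imp_le) auto
  then have "n = 7 \<or> n = 8" using n by auto
  then show "n = 8" using n by auto
qed

lemma dvd_10: "n \<ge> 7 \<Longrightarrow> int n dvd 10 \<Longrightarrow> n = 10"
proof -
  assume n: "n \<ge> 7" "int n dvd 10"
  then have "int n \<le> 10" by (intro zdvd_imp_le) auto
  then have "n \<in> {7, 8, 9, 10}" using n by auto
  then show "n = 10" using n by auto
qed

lemma dvd_18: "n \<ge> 7 \<Longrightarrow> int n dvd 18 \<Longrightarrow> n = 9 \<or> n = 18"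
proof -
  assume n: "n \<ge> 7" "int n dvd 18"
  then have "int n \<le> 18" by (intro zdvd_imp_le) auto
  then have "n \<in> {7..18}" using n by auto
  then have "n = 7 \<or> n = 8 \<or> n = 9 \<or> n = 10 \<or> n = 11 \<or> n = 12 \<or> n = 13 \<or> n = 14 \<or> n = 15 \<or> n = 16 \<or> n = 17 \<or> n = 18"
    unfolding atLeastAtMost_iff by presburger
  then show "n = 9 \<or> n = 18" using n by auto
qed

text \<open>
  A hexagon may be traversed backwards; the three rules are the rotations of the reversed sequence that
  bring the hexagons found below into the form in which the families are stated.
\<close>

lemma hexagon_edges_reflect_A: "hexagon_edges a b c d e f = hexagon_edges d c b a f e"
  by (simp add: hexagon_edges_def insert_commute)
lemma hexagon_edges_reflect_B: "hexagon_edges a b c d e f = hexagon_edges b a f e d c"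
  by (simp add: hexagon_edges_def insert_commute)
lemma hexagon_edges_reflect_C: "hexagon_edges a b c d e f = hexagon_edges c b a f e d"
  by (simp add: hexagon_edges_def insert_commute)

text \<open>
  A hexagon with both kinds of vertices has a spoke from \<open>v\<^sub>x\<close> to \<open>u\<^sub>x\<close> on it.  Starting there, follow the
  hexagon from both ends: no vertex has two spokes and no step is reversed, so after two steps on the
  \<open>u\<close> side and two on the \<open>v\<close> side only four shapes remain, and the edge that closes the hexagon
  determines a multiple of \<open>n\<close>.
\<close>

lemma mixed_hexagon:
  assumes n: "n \<ge> 7" and dist: "distinct [uu n x, b, c, d, e, vv n x]"
    and A: "adj n (uu n x) b" "adj n b c" "adj n c d" "adj n d e" "adj n e (vv n x)"
  shows "\<exists>D. is_hexagon n D \<and> edge_of n ` D = hexagon_edges (uu n x) b c d e (vv n x)"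
proof -
  have n0: "n > 0" using n by simp
  note nd = not_dvd_small[OF n]
  note eqs = uu_eq_iff[OF n0] vv_eq_iff[OF n0] uu_neq_vv nd
  \<comment> \<open>\<open>s\<close> and \<open>t\<close> are the directions in which the outer and the inner path leave the initial spoke.\<close>
  have "b = uu n (x + 1) \<or> b = uu n (x + - 1)"
    using A(1) dist by (auto dest!: adj_uuD[OF n0])
  then obtain s where s: "s = 1 \<or> s = -1" and b: "b = uu n (x + s)" by blast
  have c: "c = uu n (x + 2 * s) \<or> c = vv n (x + s)"
    using adj_uuD[OF n0, of "x + s" c] A(2) s b dist by (auto simp: eqs)
  have "e = vv n (x + 3 * 1) \<or> e = vv n (x + 3 * - 1)"
    using adj_sym[OF A(5)] dist by (auto dest!: adj_vvD[OF n0])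
  then obtain t where t: "t = 1 \<or> t = -1" and e: "e = vv n (x + 3 * t)" by blast
  have d: "d = vv n (x + 6 * t) \<or> d = uu n (x + 3 * t)"
    using adj_vvD[OF n0, of "x + 3 * t" d] adj_sym[OF A(4)] t e dist by (auto simp: eqs)
  consider (UU) "c = uu n (x + 2 * s)" "d = uu n (x + 3 * t)"
    | (UV) "c = uu n (x + 2 * s)" "d = vv n (x + 6 * t)"
    | (VU) "c = vv n (x + s)" "d = uu n (x + 3 * t)"
    | (VV) "c = vv n (x + s)" "d = vv n (x + 6 * t)"
    using c d by blast
  then show ?thesis
  proof cases
    case UU
    \<comment> \<open>The closing edge gives \<open>n\<close> dividing \<open>3 t - 2 s \<plusminus> 1\<close>, which for \<open>s = - t\<close> is \<open>\<plusminus>4\<close> or \<open>\<plusminus>6\<close>.\<close>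
    have st: "s = t"
      using adj_uuD[OF n0, of "x + 2 * s" d] A(3) UU s t by (auto simp: eqs)
    from s show ?thesis
    proof
      assume "s = 1"
      then show ?thesis using edge_of_hex_std[OF n0, of x] b UU e st
        by (intro exI[of _ "hex_std n x"]) (auto simp: is_hexagon_def)
    next
      assume "s = -1"
      then show ?thesis using edge_of_hex_std[OF n0, of "x - 3"] b UU e st
        by (intro exI[of _ "hex_std n (x - 3)"])
          (auto simp: is_hexagon_def hexagon_edges_reflect_A[of _ _ _ "uu n x"])
    qed
  next
    case UV
    \<comment> \<open>Here \<open>v\<close> with subscript \<open>x + 6 t\<close> is joined to \<open>u\<close> with subscript \<open>x + 2 s\<close>.\<close>
    have st: "int n dvd 8 \<and> s = - t"
      using adj_uuD[OF n0, of "x + 2 * s" d] A(3) UV s t by (auto simp: eqs)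
    then have 8: "n = 8" using dvd_8[OF n] by blast
    from s show ?thesis
    proof
      assume s1: "s = 1"
      have "vv 8 (x - 6) = vv 8 (x + 2)" "vv 8 (x - 3) = vv 8 (x + 5)"
        by (simp_all add: vv_eq_iff)
      then show ?thesis using edge_of_hex_22[of x] b UV e st s1
        by (intro exI[of _ "hex_22 n x"]) (auto simp: is_hexagon_def 8)
    next
      assume s1: "s = -1"
      have "vv 8 (x + 6) = vv 8 (x - 2)"
        by (simp_all add: vv_eq_iff)
      then show ?thesis using edge_of_hex_22[of "x - 2"] b UV e st s1
        by (intro exI[of _ "hex_22 n (x - 2)"]) (auto simp: is_hexagon_def 8 hexagon_edges_reflect_C[of _ _ "uu 8 x"] add.commute[of 3 x])
    qed
  next
    case VU
    show ?thesis
      using adj_vvD[OF n0, of "x + s" d] A(3) VU s t by (auto simp: eqs)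
  next
    case VV
    \<comment> \<open>The closing inner edge gives \<open>n\<close> dividing \<open>6 t - s \<plusminus> 3\<close>; only the values \<open>\<plusminus>8\<close> and \<open>\<plusminus>10\<close> are large enough.\<close>
    have "int n dvd 8 \<and> s = t \<or> int n dvd 10 \<and> s = - t"
      using adj_vvD[OF n0, of "x + s" d] A(3) VV s t by (auto simp: eqs)
    then consider "n = 8" "s = t" | "n = 10" "s = - t"
      using dvd_8[OF n] dvd_10[OF n] by blast
    then show ?thesis
    proof cases
      case 1
      from s show ?thesis
      proof
        assume s1: "s = 1"
        then show ?thesis using edge_of_hex_13_forward[of x] b VV e 1
          by (intro exI[of _ "hex_13_forward n x"]) (auto simp: is_hexagon_def 1)
      next
        assume s1: "s = -1"
        have "vv 8 (x - 6) = vv 8 (x + 2)" "vv 8 (x - 3) = vv 8 (x + 5)"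
          by (simp_all add: vv_eq_iff)
        then show ?thesis using edge_of_hex_13_forward[of "x - 1"] b VV e 1 s1
          by (intro exI[of _ "hex_13_forward n (x - 1)"])
            (auto simp: is_hexagon_def 1 hexagon_edges_reflect_B[of _ "uu 8 x"] add.commute[of "numeral k" x for k])
      qed
    next
      case 2
      from s show ?thesis
      proof
        assume s1: "s = 1"
        have "vv 10 (x - 6) = vv 10 (x + 4)" "vv 10 (x - 3) = vv 10 (x + 7)"
          by (simp_all add: vv_eq_iff)
        then show ?thesis using edge_of_hex_13_backward[of x] b VV e 2 s1
          by (intro exI[of _ "hex_13_backward n x"]) (auto simp: is_hexagon_def)
      next
        assume s1: "s = -1"
        then show ?thesis using edge_of_hex_13_backward[of "x - 1"] b VV e 2
          by (intro exI[of _ "hex_13_backward n (x - 1)"])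
            (auto simp: is_hexagon_def hexagon_edges_reflect_B[of _ "uu 10 x"] add.commute[of "numeral k" x for k])
      qed
    qed
  qed
qed

text \<open>
  All steps around the outer rim go in the same direction, and six of them return only if \<open>n\<close> divides \<open>6\<close>.
\<close>

lemma no_outer_hexagon:
  assumes n: "n \<ge> 7" and dist: "distinct [uu n x, b, c, d, e, f]"
    and A: "adj n (uu n x) b" "adj n b c" "adj n c d" "adj n d e" "adj n e f" "adj n f (uu n x)"
    and U: "\<And>y. vv n y \<notin> {b, c, d, e, f}"
  shows False
proof -
  have n0: "n > 0" using n by simp
  note eqs = uu_eq_iff[OF n0] vv_eq_iff[OF n0] uu_neq_vv not_dvd_small[OF n]
  have "b = uu n (x + 1) \<or> b = uu n (x + - 1)"
    using A(1) U by (auto dest!: adj_uuD[OF n0])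
  then obtain s where s: "s = 1 \<or> s = -1" and b: "b = uu n (x + s)" by blast
  have c: "c = uu n (x + 2 * s)"
    using adj_uuD[OF n0, of "x + s" c] A(2) s b dist U by (auto simp: eqs)
  have d: "d = uu n (x + 3 * s)"
    using adj_uuD[OF n0, of "x + 2 * s" d] A(3) s b c dist U by (auto simp: eqs)
  have e: "e = uu n (x + 4 * s)"
    using adj_uuD[OF n0, of "x + 3 * s" e] A(4) s b c d dist U by (auto simp: eqs)
  have f: "f = uu n (x + 5 * s)"
    using adj_uuD[OF n0, of "x + 4 * s" f] A(5) s b c d e dist U by (auto simp: eqs)
  show False
    using adj_uuD[OF n0, of x f] adj_sym[OF A(6)] s f U by (auto simp: eqs)
qed

text \<open>
  Six inner steps in the same direction return only if \<open>n\<close> divides \<open>18\<close>; for \<open>n = 9\<close> the walk would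
  already close after three steps.
\<close>

lemma inner_hexagon:
  assumes n: "n \<ge> 7" and dist: "distinct [vv n x, b, c, d, e, f]"
    and A: "adj n (vv n x) b" "adj n b c" "adj n c d" "adj n d e" "adj n e f" "adj n f (vv n x)"
    and U: "\<And>y. uu n y \<notin> {b, c, d, e, f}"
  shows "\<exists>D. is_hexagon n D \<and> edge_of n ` D = hexagon_edges (vv n x) b c d e f"
proof -
  have n0: "n > 0" using n by simp
  note eqs = uu_eq_iff[OF n0] vv_eq_iff[OF n0] uu_neq_vv not_dvd_small[OF n]
  have "b = vv n (x + 3 * 1) \<or> b = vv n (x + 3 * - 1)"
    using A(1) U by (auto dest!: adj_vvD[OF n0])
  then obtain s where s: "s = 1 \<or> s = -1" and b: "b = vv n (x + 3 * s)" by blast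
  have c: "c = vv n (x + 6 * s)"
    using adj_vvD[OF n0, of "x + 3 * s" c] A(2) s b dist U by (auto simp: eqs)
  have d: "d = vv n (x + 9 * s)"
    using adj_vvD[OF n0, of "x + 6 * s" d] A(3) s b c dist U by (auto simp: eqs)
  have e: "e = vv n (x + 12 * s)"
    using adj_vvD[OF n0, of "x + 9 * s" e] A(4) s b c d dist U by (auto simp: eqs)
  have f: "f = vv n (x + 15 * s)"
    using adj_vvD[OF n0, of "x + 12 * s" f] A(5) s b c d e dist U by (auto simp: eqs)
  \<comment> \<open>The case \<open>12\<close> is a last step that runs backwards, so that the fifth vertex equals the first.\<close>
  have "int n dvd 18 \<or> int n dvd 12"
    using adj_vvD[OF n0, of x f] adj_sym[OF A(6)] s f U by (auto simp: eqs)
  moreover have "\<not> int n dvd 12" using dist e s by (auto simp: eqs)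
  moreover have "n \<noteq> 9" using dist d s by (auto simp: eqs)
  ultimately have 18: "n = 18" using dvd_18[OF n] by blast
  from s show ?thesis
  proof
    assume s1: "s = 1"
    then show ?thesis using edge_of_hex_inner[of x] b c d e f 18
      by (intro exI[of _ "hex_inner n x"]) (auto simp: is_hexagon_def)
  next
    assume s1: "s = -1"
    have "vv 18 (x - 3) = vv 18 (x + 15)" "vv 18 (x - 6) = vv 18 (x + 12)"
      "vv 18 (x - 9) = vv 18 (x + 9)" "vv 18 (x - 12) = vv 18 (x + 6)" "vv 18 (x - 15) = vv 18 (x + 3)"
      by (simp_all add: vv_eq_iff)
    then show ?thesis using edge_of_hex_inner[of x] b c d e f 18 s1
      by (intro exI[of _ "hex_inner n x"])
        (auto simp: is_hexagon_def hexagon_edges_def insert_commute)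
  qed
qed

lemma adj_vertex:
  assumes "n > 0" "adj n p q"
  shows "(\<exists>x. p = uu n x) \<or> (\<exists>x. p = vv n x)"
proof -
  obtain e where "e < 3 * n" "edge_of n e = {p, q}" using assms(2) unfolding adj_def by blast
  from assms(1) this(1) show ?thesis
    by (cases rule: edge_of_residueE) (use \<open>edge_of n e = {p, q}\<close> in \<open>auto simp: doubleton_eq_iff\<close>)
qed

text \<open>
  If the walk visits both kinds of vertices, it passes from some \<open>v\<close> to a \<open>u\<close> somewhere, and rotating it
  to that place leads to \<open>mixed_hexagon\<close>.
\<close>

lemma closed_walk_is_hexagon:
  assumes n: "n \<ge> 7" and w: "inj_on w {..<6}" and A: "\<And>i. i < 6 \<Longrightarrow> adj n (w i) (w ((i + 1) mod 6))"
  shows "\<exists>D. is_hexagon n D \<and> edge_of n ` D = closed_walk_edges 6 w"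
proof -
  have n0: "n > 0" using n by simp
  define isU where "isU i \<longleftrightarrow> (\<exists>x. w i = uu n x)" for i
  define isV where "isV i \<longleftrightarrow> (\<exists>x. w i = vv n x)" for i
  have UV: "isU i \<or> isV i" if "i < 6" for i
    using adj_vertex[OF n0 A[OF that]] by (simp add: isU_def isV_def)
  have notUV: "\<not> (isU i \<and> isV i)" for i
    by (auto simp: isU_def isV_def uu_neq_vv)
  show ?thesis
  proof (cases "\<exists>i<6. isV i \<and> isU ((i + 1) mod 6)")
    case True
    then obtain i where i: "i < 6" "isV i" "isU ((i + 1) mod 6)" by blast
    define w' where "w' = (\<lambda>j. w ((j + (i + 1)) mod 6))"
    have inj: "inj_on w' {..<6}" unfolding w'_def by (rule inj_on_rotate[OF _ w]) simp
    have E: "closed_walk_edges 6 w' = closed_walk_edges 6 w"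
      unfolding w'_def by (rule closed_walk_edges_rotate) simp
    have A': "adj n (w' j) (w' ((j + 1) mod 6))" for j
    proof -
      have "((j + (i + 1)) mod 6 + 1) mod 6 = ((j + 1) mod 6 + (i + 1)) mod 6"
        unfolding mod_add_left_eq by (simp only: ac_simps)
      then show ?thesis using A[of "(j + (i + 1)) mod 6"] by (simp add: w'_def)
    qed
    obtain x where x: "w' 0 = uu n x" using i(3) by (auto simp: w'_def isU_def)
    obtain y where y: "w' 5 = vv n y" using i(1,2) by (auto simp: w'_def isV_def)
    have "w' 5 = vv n x"
      using adj_sym[OF A'[of 5]] adj_uuD[OF n0, of x "w' 5"] x y by (auto simp: uu_neq_vv)
    moreover have "adj n (w' 0) (w' 1)" "adj n (w' 1) (w' 2)" "adj n (w' 2) (w' 3)"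
      "adj n (w' 3) (w' 4)" "adj n (w' 4) (w' 5)"
      using A'[of 0] A'[of 1] A'[of 2] A'[of 3] A'[of 4] by (simp_all flip: numeral_2_eq_2)
    ultimately have "\<exists>D. is_hexagon n D \<and> edge_of n ` D = hexagon_edges (uu n x) (w' 1) (w' 2) (w' 3) (w' 4) (vv n x)"
      using inj[unfolded inj_on_6] x by (intro mixed_hexagon[OF n]) simp_all
    then show ?thesis
      using E closed_walk_edges_6[of w'] x \<open>w' 5 = vv n x\<close> by simp
  next
    case False
    then have step: "isV ((i + 1) mod 6)" if "isV i" "i < 6" for i
      using that UV[of "(i + 1) mod 6"] by auto
    have Vs: "isV 0 \<Longrightarrow> isV 1" "isV 1 \<Longrightarrow> isV 2" "isV 2 \<Longrightarrow> isV 3" "isV 3 \<Longrightarrow> isV 4" "isV 4 \<Longrightarrow> isV 5"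
      "isV 5 \<Longrightarrow> isV 0"
      using step[of 0] step[of 1] step[of 2] step[of 3] step[of 4] step[of 5]
      by (simp_all flip: numeral_2_eq_2)
    have adjs: "adj n (w 0) (w 1)" "adj n (w 1) (w 2)" "adj n (w 2) (w 3)"
      "adj n (w 3) (w 4)" "adj n (w 4) (w 5)" "adj n (w 5) (w 0)"
      using A[of 0] A[of 1] A[of 2] A[of 3] A[of 4] A[of 5] by (simp_all flip: numeral_2_eq_2)
    show ?thesis
    proof (cases "isV 0")
      case True
      then obtain x where x: "w 0 = vv n x" by (auto simp: isV_def)
      have "\<not> isU 1" "\<not> isU 2" "\<not> isU 3" "\<not> isU 4" "\<not> isU 5" using Vs True notUV by blast+
      then have "uu n y \<notin> {w 1, w 2, w 3, w 4, w 5}" for y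
        unfolding isU_def by (metis empty_iff insert_iff)
      then have "\<exists>D. is_hexagon n D \<and> edge_of n ` D = hexagon_edges (vv n x) (w 1) (w 2) (w 3) (w 4) (w 5)"
        using w[unfolded inj_on_6] adjs x by (intro inner_hexagon[OF n]) simp_all
      then show ?thesis unfolding closed_walk_edges_6 x .
    next
      case False
      then obtain x where x: "w 0 = uu n x" using UV[of 0] by (auto simp: isU_def)
      have "\<not> isV 1" "\<not> isV 2" "\<not> isV 3" "\<not> isV 4" "\<not> isV 5" using Vs False by blast+
      then have "vv n y \<notin> {w 1, w 2, w 3, w 4, w 5}" for y
        unfolding isV_def by (metis empty_iff insert_iff)
      then have False
        using w[unfolded inj_on_6] adjs x
        by (intro no_outer_hexagon[OF n, of x "w 1" "w 2" "w 3" "w 4" "w 5"]) simp_all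
      then show ?thesis ..
    qed
  qed
qed

lemma is_hexagon_subset:
  assumes "n > 0" "is_hexagon n D"
  shows "D \<subseteq> {..<3 * n}"
proof -
  obtain x where "D \<in> {hex_std n x, hex_13_forward n x, hex_22 n x, hex_13_backward n x, hex_inner n x}"
    using assms(2) unfolding is_hexagon_def by blast
  then show ?thesis using hex_subset_edges[OF assms(1), of x] by blast
qed

lemma hexagons_eq_is_hexagon:
  assumes n: "n \<ge> 7"
  shows "hexagons n = {D. is_hexagon n D}"
proof (intro equalityI subsetI)
  fix D assume "D \<in> hexagons n"
  then obtain w where D: "D \<subseteq> {..<3 * n}" and w: "inj_on w {..<6}" "edge_of n ` D = closed_walk_edges 6 w"
    unfolding hexagons_def by blast
  have "adj n (w i) (w ((i + 1) mod 6))" if "i < 6" for i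
  proof -
    have "{w i, w ((i + 1) mod 6)} \<in> edge_of n ` D"
      using that unfolding w(2) closed_walk_edges_def by blast
    then show ?thesis using D unfolding adj_def by auto
  qed
  then obtain D' where "is_hexagon n D'" "edge_of n ` D' = edge_of n ` D"
    using closed_walk_is_hexagon[OF n w(1)] w(2) by auto
  moreover have "D' = D"
    using inj_on_image_eq_iff[OF inj_on_edge_of[OF n]] calculation D is_hexagon_subset[of n D'] n by simp
  ultimately show "D \<in> {D. is_hexagon n D}" by simp
qed (use is_hexagon_imp_hexagons[OF n] in blast)

text \<open>
  Executable versions of the families, with subscripts from \<open>0\<close> to \<open>n - 1\<close>.
\<close>

definition hex_std_list :: "nat \<Rightarrow> nat \<Rightarrow> nat list" where
  "hex_std_list n i = [i, (i + 1) mod n, (i + 2) mod n, n + i, n + (i + 3) mod n, 2 * n + i]"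
definition hex_13_forward_list :: "nat \<Rightarrow> nat \<Rightarrow> nat list" where
  "hex_13_forward_list n i = [i, n + i, n + (i + 1) mod n, 2 * n + i, 2 * n + (i + 3) mod n, 2 * n + (i + 6) mod n]"
definition hex_22_list :: "nat \<Rightarrow> nat \<Rightarrow> nat list" where
  "hex_22_list n i = [i, (i + 1) mod n, n + i, n + (i + 2) mod n, 2 * n + (i + 2) mod n, 2 * n + (i + 5) mod n]"
definition hex_13_backward_list :: "nat \<Rightarrow> nat \<Rightarrow> nat list" where
  "hex_13_backward_list n i = [i, n + i, n + (i + 1) mod n, 2 * n + (i + 1) mod n, 2 * n + (i + 4) mod n, 2 * n + (i + 7) mod n]"
definition hex_inner_list :: "nat \<Rightarrow> nat \<Rightarrow> nat list" where
  "hex_inner_list n i = [2 * n + i, 2 * n + (i + 3) mod n, 2 * n + (i + 6) mod n, 2 * n + (i + 9) mod n,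
    2 * n + (i + 12) mod n, 2 * n + (i + 15) mod n]"

text \<open>
  For \<open>n = 18\<close> the list contains each of the three inner hexagons six times, once for each starting point.
\<close>

definition hexagon_list :: "nat \<Rightarrow> nat list list" where
  "hexagon_list n = map (hex_std_list n) [0..<n] @
     (if n = 8 then map (hex_13_forward_list n) [0..<n] @ map (hex_22_list n) [0..<n]
      else if n = 10 then map (hex_13_backward_list n) [0..<n]
      else if n = 18 then map (hex_inner_list n) [0..<n] else [])"

lemma residues_add:
  assumes "i < n"
  shows "outer n (int i) = i" "spoke n (int i) = n + i" "inner n (int i) = 2 * n + i"
    "outer n (int i + numeral k) = (i + numeral k) mod n" "outer n (int i + 1) = (i + 1) mod n"
    "spoke n (int i + numeral k) = n + (i + numeral k) mod n" "spoke n (int i + 1) = n + (i + 1) mod n"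
    "inner n (int i + numeral k) = 2 * n + (i + numeral k) mod n" "inner n (int i + 1) = 2 * n + (i + 1) mod n"
proof -
  have "nat ((int i + int m) mod int n) = (i + m) mod n" for m
    by (metis nat_int of_nat_add zmod_int)
  from this[of 0] this[of 1] this[of "numeral k"] assms
  show "outer n (int i) = i" "spoke n (int i) = n + i" "inner n (int i) = 2 * n + i"
    "outer n (int i + numeral k) = (i + numeral k) mod n" "outer n (int i + 1) = (i + 1) mod n"
    "spoke n (int i + numeral k) = n + (i + numeral k) mod n" "spoke n (int i + 1) = n + (i + 1) mod n"
    "inner n (int i + numeral k) = 2 * n + (i + numeral k) mod n" "inner n (int i + 1) = 2 * n + (i + 1) mod n"
    by (simp_all add: outer_def spoke_def inner_def)
qed

lemma set_hex_lists:
  assumes "i < n"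
  shows "set (hex_std_list n i) = hex_std n (int i)" "set (hex_13_forward_list n i) = hex_13_forward n (int i)"
    "set (hex_22_list n i) = hex_22 n (int i)" "set (hex_13_backward_list n i) = hex_13_backward n (int i)"
    "set (hex_inner_list n i) = hex_inner n (int i)"
  unfolding hex_std_list_def hex_13_forward_list_def hex_22_list_def hex_13_backward_list_def hex_inner_list_def
    hex_std_def hex_13_forward_def hex_22_def hex_13_backward_def hex_inner_def
    residues_add[OF assms] by simp_all

lemma hex_mod:
  shows "hex_std n (x mod int n) = hex_std n x" "hex_13_forward n (x mod int n) = hex_13_forward n x"
    "hex_22 n (x mod int n) = hex_22 n x" "hex_13_backward n (x mod int n) = hex_13_backward n x"
    "hex_inner n (x mod int n) = hex_inner n x"
  unfolding hex_std_def hex_13_forward_def hex_22_def hex_13_backward_def hex_inner_def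
    outer_def spoke_def inner_def by (simp_all add: mod_simps)

lemma hexagons_eq:
  assumes n: "n \<ge> 7"
  shows "hexagons n = set ` set (hexagon_list n)"
proof -
  have *: "(\<exists>x. D = f x) \<longleftrightarrow> (\<exists>i<n. D = set (g i))"
    if f: "\<And>x. f (x mod int n) = f x" and g: "\<And>i. i < n \<Longrightarrow> set (g i) = f (int i)"
    for f :: "int \<Rightarrow> nat set" and g D
  proof
    assume "\<exists>x. D = f x"
    then obtain x where "D = f x" ..
    moreover have "x mod int n = int (nat (x mod int n))" "nat (x mod int n) < n"
      using n by (simp_all add: nat_less_iff)
    ultimately show "\<exists>i<n. D = set (g i)" using f[of x] g[of "nat (x mod int n)"] by metis
  qed (use g in blast)
  have **: "(\<exists>x. D = hex_std n x) \<longleftrightarrow> (\<exists>i<n. D = set (hex_std_list n i))"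
    "(\<exists>x. D = hex_13_forward n x) \<longleftrightarrow> (\<exists>i<n. D = set (hex_13_forward_list n i))"
    "(\<exists>x. D = hex_22 n x) \<longleftrightarrow> (\<exists>i<n. D = set (hex_22_list n i))"
    "(\<exists>x. D = hex_13_backward n x) \<longleftrightarrow> (\<exists>i<n. D = set (hex_13_backward_list n i))"
    "(\<exists>x. D = hex_inner n x) \<longleftrightarrow> (\<exists>i<n. D = set (hex_inner_list n i))" for D
    by (rule *; simp add: hex_mod set_hex_lists)+
  have image: "D \<in> set ` set (map g [0..<m]) \<longleftrightarrow> (\<exists>i<m. D = set (g i))" for g :: "nat \<Rightarrow> nat list" and D m
    by auto
  have "is_hexagon n D \<longleftrightarrow> (\<exists>x. D = hex_std n x) \<or>
     n = 8 \<and> ((\<exists>x. D = hex_13_forward n x) \<or> (\<exists>x. D = hex_22 n x)) \<or>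
     n = 10 \<and> (\<exists>x. D = hex_13_backward n x) \<or> n = 18 \<and> (\<exists>x. D = hex_inner n x)" for D
    unfolding is_hexagon_def by blast
  then have "is_hexagon n D \<longleftrightarrow> D \<in> set ` set (hexagon_list n)" for D
    unfolding ** hexagon_list_def
    by (cases "n = 8"; cases "n = 10"; cases "n = 18")
      (simp_all only: image set_append image_Un Un_iff simp_thms if_True if_False list.set image_empty empty_iff)
  then show ?thesis unfolding hexagons_eq_is_hexagon[OF n] by blast
qed

section \<open>Color classes and the hexagons they hit\<close>

text \<open>
  The counting is done for an abstract family of sets \<open>C i\<close>, \<open>i \<in> I\<close>, of edges.  Indexing the family makes
  it possible to count a hexagon with multiplicity.
\<close>

definition hits :: "'i set \<Rightarrow> ('i \<Rightarrow> 'e set) \<Rightarrow> 'e set \<Rightarrow> 'i set" where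
  "hits I C T = {i \<in> I. \<exists>x\<in>T. \<exists>y\<in>T. x \<noteq> y \<and> x \<in> C i \<and> y \<in> C i}"

definition deg :: "'i set \<Rightarrow> ('i \<Rightarrow> 'e set) \<Rightarrow> 'e \<Rightarrow> nat" where
  "deg I C x = card {i \<in> I. x \<in> C i}"

definition codeg :: "'i set \<Rightarrow> ('i \<Rightarrow> 'e set) \<Rightarrow> 'e \<Rightarrow> 'e \<Rightarrow> nat" where
  "codeg I C x y = card {i \<in> I. x \<in> C i \<and> y \<in> C i}"

lemma codeg_le_deg: "finite I \<Longrightarrow> codeg I C x y \<le> deg I C x"
  unfolding codeg_def deg_def by (intro card_mono) auto
lemma codeg_commute: "codeg I C x y = codeg I C y x"
  unfolding codeg_def by (simp add: conj_commute)

lemma hits_subset: "hits I C T \<subseteq> I"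
  by (auto simp: hits_def)

lemma hits_doubleton: "x \<noteq> y \<Longrightarrow> card (hits I C {x, y}) = codeg I C x y"
  unfolding codeg_def by (rule arg_cong[where f = card]) (auto simp: hits_def)

lemma hits_card_le_1:
  assumes "finite T" "card T \<le> 1"
  shows "hits I C T = {}"
  using assms card_le_Suc0_iff_eq[of T] by (auto simp: hits_def)

lemma sum_deg:
  assumes "finite I" "finite T"
  shows "(\<Sum>x\<in>T. deg I C x) = (\<Sum>i\<in>I. card (T \<inter> C i))"
proof -
  have "(\<Sum>x\<in>T. deg I C x) = (\<Sum>x\<in>T. \<Sum>i\<in>I. if x \<in> C i then 1 else 0)"
    using assms(1) by (simp add: deg_def sum.If_cases Int_def)
  also have "\<dots> = (\<Sum>i\<in>I. \<Sum>x\<in>T. if x \<in> C i then 1 else 0)"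
    by (rule sum.swap)
  also have "\<dots> = (\<Sum>i\<in>I. card (T \<inter> C i))"
    using assms(2) by (simp add: sum.If_cases Int_def)
  finally show ?thesis .
qed

lemma two_le_card_Int_hits:
  assumes "finite T" "i \<in> hits I C T"
  shows "2 \<le> card (T \<inter> C i)"
proof -
  obtain x y where "x \<noteq> y" "{x, y} \<subseteq> T \<inter> C i" using assms(2) by (auto simp: hits_def)
  then show ?thesis using card_mono[of "T \<inter> C i" "{x, y}"] assms(1) by simp
qed

text \<open>
  Double counting of incidences between \<open>T\<close> and the family: a set that is hit contributes at least two, and
  a set that is met without being hit contributes one.
\<close>

lemma card_hits_le:
  assumes "finite I" "finite T"
  shows "2 * card (hits I C T) + card {i \<in> I - hits I C T. T \<inter> C i \<noteq> {}} \<le> (\<Sum>x\<in>T. deg I C x)"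
proof -
  let ?M = "{i \<in> I - hits I C T. T \<inter> C i \<noteq> {}}"
  have fin: "finite (hits I C T)" using finite_subset[OF hits_subset assms(1)] .
  have "2 * card (hits I C T) + card ?M = (\<Sum>i\<in>hits I C T. 2) + (\<Sum>i\<in>?M. 1)" by simp
  also have "\<dots> \<le> (\<Sum>i\<in>hits I C T. card (T \<inter> C i)) + (\<Sum>i\<in>?M. card (T \<inter> C i))"
    using assms(2) two_le_card_Int_hits by (intro add_mono sum_mono) (auto simp: Suc_le_eq card_gt_0_iff)
  also have "\<dots> = (\<Sum>i\<in>hits I C T \<union> ?M. card (T \<inter> C i))"
    using assms(1) fin by (intro sum.union_disjoint[symmetric]) auto
  also have "\<dots> \<le> (\<Sum>i\<in>I. card (T \<inter> C i))"
    using assms(1) hits_subset[of I C T] by (intro sum_mono2) auto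
  finally show ?thesis by (simp add: sum_deg assms)
qed

definition color_classes :: "('e \<Rightarrow> 'c) \<Rightarrow> 'e set \<Rightarrow> 'e set set" where
  "color_classes c E = (\<lambda>k. {e \<in> E. c e = k}) ` c ` E"

lemma color_classesD:
  assumes "T \<in> color_classes c E" "finite E"
  shows "T \<subseteq> E" "finite T" "T \<noteq> {}" "card T \<ge> 1"
  using assms finite_subset[of T E] by (auto simp: color_classes_def Suc_le_eq card_gt_0_iff)

lemma finite_color_classes: "finite E \<Longrightarrow> finite (color_classes c E)"
  by (simp add: color_classes_def)

text \<open>
  The deficit of a coloring as the sum of the costs \<open>|T| - 1\<close> of its classes.
\<close>

lemma sum_rank_color_classes:
  assumes "finite E"
  shows "(\<Sum>T\<in>color_classes c E. card T - 1) + card (c ` E) = card E"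
proof -
  have inj: "inj_on (\<lambda>k. {e \<in> E. c e = k}) (c ` E)"
    by (rule inj_onI) blast
  have "card E = (\<Sum>k\<in>c ` E. card {e \<in> E. c e = k})"
    using sum.image_gen[of E "\<lambda>_. 1 :: nat" c] assms by simp
  also have "\<dots> = (\<Sum>T\<in>color_classes c E. card T)"
    unfolding color_classes_def by (simp add: sum.reindex[OF inj])
  also have "\<dots> = (\<Sum>T\<in>color_classes c E. (card T - 1) + 1)"
    by (rule sum.cong[OF refl], drule color_classesD(4)[OF _ assms]) linarith
  also have "\<dots> = (\<Sum>T\<in>color_classes c E. card T - 1) + card (color_classes c E)"
    by (simp only: sum.distrib) simp
  also have "card (color_classes c E) = card (c ` E)"
    unfolding color_classes_def by (rule card_image[OF inj])
  finally show ?thesis by simp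
qed

lemma hits_cover:
  assumes "\<And>i. i \<in> I \<Longrightarrow> C i \<subseteq> E \<and> \<not> inj_on c (C i)"
  shows "I \<subseteq> (\<Union>T\<in>color_classes c E. hits I C T)"
proof
  fix i assume i: "i \<in> I"
  then obtain x y where "x \<in> C i" "y \<in> C i" "x \<noteq> y" "c x = c y" "x \<in> E" "y \<in> E"
    using assms unfolding inj_on_def by blast
  then show "i \<in> (\<Union>T\<in>color_classes c E. hits I C T)"
    using i unfolding color_classes_def hits_def by auto
qed

lemma card_le_sum_hits:
  assumes "finite I" "finite K" "J \<subseteq> (\<Union>T\<in>K. hits I C T)"
  shows "card J \<le> (\<Sum>T\<in>K. card (hits I C T))"
proof -
  have "card J \<le> card (\<Union>T\<in>K. hits I C T)"
    using assms finite_subset[OF hits_subset assms(1)] by (intro card_mono) auto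
  also have "\<dots> \<le> (\<Sum>T\<in>K. card (hits I C T))" by (rule card_UN_le[OF assms(2)])
  finally show ?thesis .
qed

lemma card_hits_le_mult:
  assumes "finite I" "finite T" "\<And>x. x \<in> T \<Longrightarrow> deg I C x \<le> d"
  shows "2 * card (hits I C T) \<le> d * card T"
proof -
  have "(\<Sum>x\<in>T. deg I C x) \<le> d * card T"
    using sum_mono[of T "deg I C" "\<lambda>_. d"] assms(3) by (simp add: mult.commute)
  then show ?thesis using card_hits_le[OF assms(1,2), of C] by linarith
qed

lemma card_hits_pair_le:
  assumes "card T = 2" "\<And>x y. x \<in> T \<Longrightarrow> y \<in> T \<Longrightarrow> x \<noteq> y \<Longrightarrow> codeg I C x y \<le> d"
  shows "card (hits I C T) \<le> d"
proof -
  obtain x y where "T = {x, y}" "x \<noteq> y" using assms(1) by (auto simp: card_2_iff)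
  then show ?thesis using assms(2)[of x y] by (simp add: hits_doubleton)
qed

text \<open>
  If every edge is in at most three sets and two edges are in at most two common sets, then a class of
  size \<open>m \<ge> 2\<close> hits at most \<open>2(m - 1)\<close> sets: for \<open>m = 2\<close> by the codegree bound and for \<open>m \<ge> 3\<close> because the
  integer part of \<open>3m/2\<close> is at most \<open>2m - 2\<close>.
\<close>

lemma deficit_bound_deg_3:
  assumes I: "finite I" and E: "finite E"
    and C: "\<And>i. i \<in> I \<Longrightarrow> C i \<subseteq> E \<and> \<not> inj_on c (C i)"
    and deg: "\<And>x. x \<in> E \<Longrightarrow> deg I C x \<le> 3"
    and codeg: "\<And>x y. x \<in> E \<Longrightarrow> y \<in> E \<Longrightarrow> x \<noteq> y \<Longrightarrow> codeg I C x y \<le> 2"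
  shows "card I + 2 * card (c ` E) \<le> 2 * card E"
proof -
  have "card (hits I C T) \<le> 2 * (card T - 1)" if "T \<in> color_classes c E" for T
  proof -
    note T = color_classesD[OF that E]
    have "2 * card (hits I C T) \<le> 3 * card T"
      using card_hits_le_mult[OF I T(2)] deg T(1) by blast
    moreover have "card (hits I C T) \<le> 2" if "card T = 2"
      using card_hits_pair_le[OF that] codeg T(1) by blast
    moreover have "hits I C T = {}" if "card T \<le> 1"
      using hits_card_le_1[OF T(2) that] .
    ultimately show ?thesis by (cases "card T \<le> 1"; cases "card T = 2") auto
  qed
  then have "(\<Sum>T\<in>color_classes c E. card (hits I C T)) \<le> (\<Sum>T\<in>color_classes c E. 2 * (card T - 1))"
    by (rule sum_mono)
  moreover have "card I \<le> (\<Sum>T\<in>color_classes c E. card (hits I C T))"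
    using card_le_sum_hits[OF I finite_color_classes[OF E] hits_cover[OF C]] .
  ultimately show ?thesis
    using sum_rank_color_classes[OF E, of c] by (simp flip: sum_distrib_left)
qed

text \<open>
  With degrees up to \<open>2d\<close> and codegrees up to \<open>d\<close>, a class of size two still hits at most \<open>d\<close> sets, that is
  \<open>d\<close> per unit of cost.  From size three on the incidence count only gives \<open>d |T|\<close>, an excess of \<open>d\<close>.
\<close>

definition large_classes where
  "large_classes c E = {T \<in> color_classes c E. card T \<ge> 3}"

lemma large_class_bounds:
  assumes I: "finite I" and E: "finite E"
    and deg: "\<And>x. x \<in> E \<Longrightarrow> deg I C x \<le> 2 * d"
    and codeg: "\<And>x y. x \<in> E \<Longrightarrow> y \<in> E \<Longrightarrow> x \<noteq> y \<Longrightarrow> codeg I C x y \<le> d"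
    and T: "T \<in> color_classes c E"
  shows "card (hits I C T) \<le> d * (card T - 1) + (if card T \<ge> 3 then d else 0)"
proof -
  note T = color_classesD[OF T E]
  have "card (hits I C T) \<le> d * card T"
    using card_hits_le_mult[OF I T(2), of C "2 * d"] deg T(1) by auto
  moreover have "card (hits I C T) \<le> d" if "card T = 2"
    using card_hits_pair_le[OF that] codeg T(1) by blast
  moreover have "hits I C T = {}" if "card T \<le> 1"
    using hits_card_le_1[OF T(2) that] .
  moreover have "d * card T = d * (card T - 1) + d"
    using T(4) by (cases "card T") auto
  ultimately show ?thesis by (cases "card T \<le> 1"; cases "card T = 2") auto
qed

lemma sum_class_bounds:
  assumes "finite E"
  shows "(\<Sum>T\<in>color_classes c E. d * (card T - 1) + (if card T \<ge> 3 then d else 0))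
    = d * (card E - card (c ` E)) + d * card (large_classes c E)"
proof -
  have "(\<Sum>T\<in>color_classes c E. d * (card T - 1)) = d * (card E - card (c ` E))"
    unfolding sum_distrib_left[symmetric] sum_rank_color_classes[OF assms, of c, symmetric]
    by (simp only: add_diff_cancel_right')
  moreover have "(\<Sum>T\<in>color_classes c E. if card T \<ge> 3 then d else 0) = d * card (large_classes c E)"
    using sum.inter_filter[OF finite_color_classes[OF assms, of c],
      where g = "\<lambda>_. d" and P = "\<lambda>T. 3 \<le> card T"]
    by (simp add: large_classes_def mult.commute)
  ultimately show ?thesis by (simp add: sum.distrib)
qed

lemma large_classes_bound:
  assumes I: "finite I" and E: "finite E"
    and C: "\<And>i. i \<in> I \<Longrightarrow> C i \<subseteq> E \<and> \<not> inj_on c (C i)"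
    and deg: "\<And>x. x \<in> E \<Longrightarrow> deg I C x \<le> 2 * d"
    and codeg: "\<And>x y. x \<in> E \<Longrightarrow> y \<in> E \<Longrightarrow> x \<noteq> y \<Longrightarrow> codeg I C x y \<le> d"
  shows "card I \<le> d * (card E - card (c ` E)) + d * card (large_classes c E)"
proof -
  have "card I \<le> (\<Sum>T\<in>color_classes c E. card (hits I C T))"
    by (rule card_le_sum_hits[OF I finite_color_classes[OF E] hits_cover[OF C]])
  also have "\<dots> \<le> (\<Sum>T\<in>color_classes c E. d * (card T - 1) + (if card T \<ge> 3 then d else 0))"
    by (rule sum_mono) (rule large_class_bounds[OF I E deg codeg])
  finally show ?thesis unfolding sum_class_bounds[OF E] .
qed

text \<open>
  If the count is exact, every large class hits as many sets as its incidences permit, so that it hits every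
  set it meets, and no set is hit twice.  A set containing edges of two large classes would be hit by both.
\<close>

lemma large_classes_tight:
  assumes I: "finite I" and E: "finite E"
    and C: "\<And>i. i \<in> I \<Longrightarrow> C i \<subseteq> E \<and> \<not> inj_on c (C i)"
    and deg: "\<And>x. x \<in> E \<Longrightarrow> deg I C x \<le> 2 * d"
    and codeg: "\<And>x y. x \<in> E \<Longrightarrow> y \<in> E \<Longrightarrow> x \<noteq> y \<Longrightarrow> codeg I C x y \<le> d"
    and tight: "d * (card E - card (c ` E)) + d * card (large_classes c E) \<le> card I"
    and T: "T \<in> large_classes c E"
  shows "card (hits I C T) = d * card T"
    and "T' \<in> large_classes c E \<Longrightarrow> T \<noteq> T' \<Longrightarrow> x \<in> T \<Longrightarrow> y \<in> T' \<Longrightarrow> codeg I C x y = 0"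
proof -
  let ?K = "color_classes c E"
  let ?b = "\<lambda>T. d * (card T - 1) + (if card T \<ge> 3 then d else 0)"
  have fK: "finite ?K" by (rule finite_color_classes[OF E])
  have bound: "card (hits I C T) \<le> ?b T" if "T \<in> ?K" for T
    by (rule large_class_bounds[OF I E deg codeg that])
  have cover: "I \<subseteq> (\<Union>T\<in>?K. hits I C T)" by (rule hits_cover[OF C])
  have le: "(\<Sum>T\<in>?K. ?b T) \<le> card I" unfolding sum_class_bounds[OF E] by (rule tight)
  have eq: "card (hits I C T) = d * card T" if "T \<in> large_classes c E" for T
  proof -
    have T: "T \<in> ?K" "card T \<ge> 3" using that by (auto simp: large_classes_def)
    have "\<not> card (hits I C T) < ?b T"
    proof
      assume "card (hits I C T) < ?b T"
      then have "\<exists>T\<in>?K. card (hits I C T) < ?b T" using T(1) by blast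
      then have "(\<Sum>T\<in>?K. card (hits I C T)) < (\<Sum>T\<in>?K. ?b T)"
        using bound by (intro sum_strict_mono_ex1[OF fK]) blast+
      then show False using card_le_sum_hits[OF I fK cover] le by linarith
    qed
    then have "card (hits I C T) = ?b T" using bound[OF T(1)] by simp
    also have "?b T = d * card T" using T(2) by (cases "card T") auto
    finally show ?thesis .
  qed
  then show "card (hits I C T) = d * card T" using T .
  have hit: "i \<in> hits I C T" if "T \<in> large_classes c E" "i \<in> I" "x \<in> T" "x \<in> C i" for i T x
  proof (rule ccontr)
    have T: "T \<in> ?K" using that by (auto simp: large_classes_def)
    note T = color_classesD[OF T E]
    assume "i \<notin> hits I C T"
    then have "card {i \<in> I - hits I C T. T \<inter> C i \<noteq> {}} > 0"
      using that I by (auto simp: card_gt_0_iff)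
    moreover have "(\<Sum>x\<in>T. deg I C x) \<le> 2 * (d * card T)"
      using sum_mono[of T "deg I C" "\<lambda>_. 2 * d"] deg subsetD[OF T(1)] by (simp add: algebra_simps)
    ultimately show False
      using card_hits_le[OF I T(2), of C] eq[OF that(1)] by linarith
  qed
  assume T': "T' \<in> large_classes c E" "T \<noteq> T'" "x \<in> T" "y \<in> T'"
  have K: "T \<in> ?K" "T' \<in> ?K" using T T'(1) by (auto simp: large_classes_def)
  show "codeg I C x y = 0"
  proof (rule ccontr)
    assume "codeg I C x y \<noteq> 0"
    then obtain i where i: "i \<in> I" "x \<in> C i" "y \<in> C i"
      unfolding codeg_def by (metis (mono_tags, lifting) card.empty empty_Collect_eq)
    then have i2: "i \<in> hits I C T" "i \<in> hits I C T'" using hit T T' by blast+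
    let ?h = "hits I C"
    have fin: "finite (?h S)" for S by (rule finite_subset[OF hits_subset I])
    \<comment> \<open>As \<open>i\<close> is also hit by \<open>T'\<close>, the class \<open>T\<close> need not account for it, and one unit of the count is lost.\<close>
    have "I \<subseteq> (\<Union>S\<in>?K - {T}. ?h S) \<union> (?h T - {i})"
      using cover i2 K T'(2) by blast
    then have "card I \<le> card ((\<Union>S\<in>?K - {T}. ?h S) \<union> (?h T - {i}))"
      using fin fK by (intro card_mono) auto
    also have "\<dots> \<le> card (\<Union>S\<in>?K - {T}. ?h S) + card (?h T - {i})" by (rule card_Un_le)
    also have "\<dots> < (\<Sum>S\<in>?K - {T}. card (?h S)) + card (?h T)"
      using fin i2(1) fK card_UN_le[of "?K - {T}" ?h] by (intro add_le_less_mono card_Diff1_less) auto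
    also have "\<dots> = (\<Sum>S\<in>?K. card (?h S))" using sum.remove[OF fK K(1)] by (metis add.commute)
    also have "\<dots> \<le> (\<Sum>S\<in>?K. ?b S)" using bound by (rule sum_mono)
    finally show False using le by linarith
  qed
qed

lemma card_large_classes_le:
  assumes E: "finite E"
  shows "2 * card (large_classes c E) \<le> card E - card (c ` E)"
proof -
  have "2 * card (large_classes c E) = (\<Sum>T\<in>large_classes c E. 2)" by simp
  also have "\<dots> \<le> (\<Sum>T\<in>large_classes c E. card T - 1)"
    by (rule sum_mono) (auto simp: large_classes_def)
  also have "\<dots> \<le> (\<Sum>T\<in>color_classes c E. card T - 1)"
    using finite_color_classes[OF E] by (intro sum_mono2) (auto simp: large_classes_def)
  finally show ?thesis using sum_rank_color_classes[OF E, of c] by linarith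
qed


text \<open>
  Two classes of size three use up four of the at most six units of deficit.  The remaining classes cost
  at most two in total, so each of them has at most three edges.  If on the family \<open>R\<close> of sets missed by
  both classes the degrees are below \<open>2|R|/3\<close> and the codegrees below \<open>|R|/2\<close>, then a unit of cost hits
  fewer than \<open>|R|/2\<close> sets of \<open>R\<close>, and two units do not suffice.
\<close>

lemma residual_contradiction:
  assumes I: "finite I" and E: "finite E"
    and C: "\<And>i. i \<in> I \<Longrightarrow> C i \<subseteq> E \<and> \<not> inj_on c (C i)"
    and rank: "card E - card (c ` E) \<le> 6"
    and T: "T1 \<in> color_classes c E" "T2 \<in> color_classes c E" "T1 \<noteq> T2" "card T1 = 3" "card T2 = 3"
    and R: "R = I - hits I C T1 - hits I C T2"
    and deg: "\<And>x. x \<in> E \<Longrightarrow> 3 * deg R C x < 2 * card R"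
    and codeg: "\<And>x y. x \<in> E \<Longrightarrow> y \<in> E \<Longrightarrow> x \<noteq> y \<Longrightarrow> 2 * codeg R C x y < card R"
  shows False
proof -
  let ?K = "color_classes c E - {T1, T2}"
  have fin: "finite (color_classes c E)" "finite R" using finite_color_classes[OF E] I R by auto
  have "(\<Sum>T\<in>color_classes c E. card T - 1) = (card T1 - 1) + ((card T2 - 1) + (\<Sum>T\<in>?K. card T - 1))"
  proof -
    have "?K = color_classes c E - {T1} - {T2}" by blast
    then show ?thesis
      using sum.remove[OF fin(1) T(1), of "\<lambda>T. card T - 1"] T
        sum.remove[of "color_classes c E - {T1}" T2 "\<lambda>T. card T - 1"] fin(1) by simp
  qed
  then have rankK: "(\<Sum>T\<in>?K. card T - 1) \<le> 2"
    using sum_rank_color_classes[OF E, of c] rank T by linarith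
  obtain x where "x \<in> T1" using color_classesD(3)[OF T(1) E] by blast
  then have "card R > 0" using deg[of x] color_classesD(1)[OF T(1) E] by auto
  have bound: "2 * card (hits R C T) \<le> card R * (card T - 1)"
    and strict: "card T \<ge> 2 \<Longrightarrow> 2 * card (hits R C T) < card R * (card T - 1)" if "T \<in> ?K" for T
  proof -
    have TE: "T \<subseteq> E" "finite T" using that color_classesD[of T c E] E by auto
    have "card T - 1 \<le> (\<Sum>T\<in>?K. card T - 1)" by (rule member_le_sum) (use that fin in auto)
    then have "card T \<le> 3" using rankK by linarith
    moreover have "2 * card (hits R C T) < card R" if "card T = 2"
    proof -
      obtain x y where "T = {x, y}" "x \<noteq> y" using \<open>card T = 2\<close> by (auto simp: card_2_iff)
      then show ?thesis using codeg[of x y] TE by (simp add: hits_doubleton)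
    qed
    moreover have "2 * card (hits R C T) < 2 * card R" if "card T = 3"
    proof -
      have "3 * (2 * card (hits R C T)) \<le> (\<Sum>x\<in>T. 3 * deg R C x)"
        using card_hits_le[OF fin(2) TE(2), of C] by (simp flip: sum_distrib_left)
      also have "\<dots> < (\<Sum>x\<in>T. 2 * card R)"
        using TE deg that by (intro sum_strict_mono) auto
      finally show ?thesis using that by simp
    qed
    moreover have "hits R C T = {}" if "card T \<le> 1" using hits_card_le_1[OF TE(2) that] .
    moreover have "card T = 0 \<or> card T = 1 \<or> card T = 2 \<or> card T = 3" using \<open>card T \<le> 3\<close> by linarith
    ultimately show "2 * card (hits R C T) \<le> card R * (card T - 1)"
      and "card T \<ge> 2 \<Longrightarrow> 2 * card (hits R C T) < card R * (card T - 1)" by auto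
  qed
  have cover: "R \<subseteq> (\<Union>T\<in>?K. hits R C T)"
  proof
    fix i assume i: "i \<in> R"
    have "I \<subseteq> (\<Union>T\<in>color_classes c E. hits I C T)" by (rule hits_cover[OF C])
    then obtain T where T': "T \<in> color_classes c E" "i \<in> hits I C T"
      using i R by blast
    then have "T \<in> ?K" using i R by blast
    moreover have "i \<in> hits R C T" using T'(2) i by (auto simp: hits_def)
    ultimately show "i \<in> (\<Union>T\<in>?K. hits R C T)" by blast
  qed
  obtain i where "i \<in> R" using \<open>card R > 0\<close> by (metis card_gt_0_iff equals0I)
  then obtain T where TK: "T \<in> ?K" "i \<in> hits R C T" using cover by blast
  have "finite T" using TK(1) color_classesD(2)[of T c E] E by blast
  then have "card T \<ge> 2" using hits_card_le_1[of T R C] TK(2) by (cases "card T \<le> 1") auto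
  then have "\<exists>T\<in>?K. 2 * card (hits R C T) < card R * (card T - 1)" using strict TK by blast
  then have "(\<Sum>T\<in>?K. 2 * card (hits R C T)) < (\<Sum>T\<in>?K. card R * (card T - 1))"
    using bound fin by (intro sum_strict_mono_ex1) blast+
  also have "\<dots> \<le> card R * 2" unfolding sum_distrib_left[symmetric] using rankK by (rule mult_le_mono2)
  finally show False
    using card_le_sum_hits[OF fin(2) _ cover] fin(1) by (simp flip: sum_distrib_left)
qed


section \<open>Upper bound for general n\<close>

text \<open>
  At most one standard hexagon has a given edge at a given position.  Hence degrees are bounded by the
  number of positions of the kind of edge: three for outer edges, two for spokes, one for inner edges.
\<close>

lemma card_shift_le_1:
  fixes k n x :: nat
  assumes "k < n"
  shows "card {i. i < n \<and> (i + k) mod n = x} \<le> 1"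
proof -
  have "i = j" if "i < n" "j < n" "(i + k) mod n = (j + k) mod n" for i j
    using that assms by (auto simp: mod_if split: if_splits)
  then show ?thesis by (auto simp: card_le_Suc0_iff_eq)
qed

lemma deg_hex_std_list:
  assumes n: "n \<ge> 7" "x < 3 * n"
  shows "deg {..<n} (\<lambda>i. set (hex_std_list n i)) x \<le> (if x < n then 3 else 2)"
proof -
  let ?S = "\<lambda>k x. {i. i < n \<and> (i + k) mod n = x}"
  have S: "card (?S 0 y) \<le> 1" "card (?S 1 y) \<le> 1" "card (?S 2 y) \<le> 1" "card (?S 3 y) \<le> 1" for y
    using n(1) by (intro card_shift_le_1; simp)+
  consider "x < n" | "n \<le> x" "x < 2 * n" | "2 * n \<le> x" by linarith
  then show ?thesis
  proof cases
    case 1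
    have "{i \<in> {..<n}. x \<in> set (hex_std_list n i)} \<subseteq> ?S 0 x \<union> (?S 1 x \<union> ?S 2 x)"
      using 1 by (auto simp: hex_std_list_def)
    then have "deg {..<n} (\<lambda>i. set (hex_std_list n i)) x \<le> card (?S 0 x \<union> (?S 1 x \<union> ?S 2 x))"
      unfolding deg_def by (intro card_mono) auto
    also have "\<dots> \<le> card (?S 0 x) + (card (?S 1 x) + card (?S 2 x))"
      by (meson card_Un_le add_left_mono order_trans)
    finally show ?thesis using 1 S(1-3)[of x] by simp
  next
    case 2
    have small: "\<not> n \<le> (i + k) mod n" for i k using n(1) by (simp add: not_le)
    have "{i \<in> {..<n}. x \<in> set (hex_std_list n i)} \<subseteq> ?S 0 (x - n) \<union> ?S 3 (x - n)"
    proof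
      fix i assume "i \<in> {i \<in> {..<n}. x \<in> set (hex_std_list n i)}"
      then have "i < n" "x = n + i \<or> x = n + (i + 3) mod n"
        using 2 small[of i 1] small[of i 2] by (auto simp: hex_std_list_def)
      then show "i \<in> ?S 0 (x - n) \<union> ?S 3 (x - n)" by auto
    qed
    then have "deg {..<n} (\<lambda>i. set (hex_std_list n i)) x \<le> card (?S 0 (x - n) \<union> ?S 3 (x - n))"
      unfolding deg_def by (intro card_mono) auto
    also have "\<dots> \<le> card (?S 0 (x - n)) + card (?S 3 (x - n))" by (rule card_Un_le)
    finally show ?thesis using 2 S(1,4)[of "x - n"] by simp
  next
    case 3
    have small: "\<not> 2 * n \<le> (i + k) mod n" "\<not> n \<le> (i + k) mod n" for i k
      using mod_less_divisor[of n "i + k"] n(1) by linarith+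
    have "{i \<in> {..<n}. x \<in> set (hex_std_list n i)} \<subseteq> ?S 0 (x - 2 * n)"
    proof
      fix i assume "i \<in> {i \<in> {..<n}. x \<in> set (hex_std_list n i)}"
      then have "i < n" "x = 2 * n + i"
        using 3 small[of i 1] small[of i 2] small[of i 3] by (auto simp: hex_std_list_def)
      then show "i \<in> ?S 0 (x - 2 * n)" by auto
    qed
    then have "deg {..<n} (\<lambda>i. set (hex_std_list n i)) x \<le> card (?S 0 (x - 2 * n))"
      unfolding deg_def by (intro card_mono) auto
    then show ?thesis using 3 S(1)[of "x - 2 * n"] by simp
  qed
qed

text \<open>
  Only two outer edges \<open>x\<close> and \<open>y\<close> need an argument.  The hexagons through \<open>x\<close> have \<open>x\<close> as their first,
  second or third outer edge, and one of these positions is incompatible with \<open>y\<close>: the third if \<open>y\<close> follows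
  \<open>x\<close>, the second if \<open>y\<close> is the next but one, and the first otherwise.
\<close>

lemma codeg_hex_std_list:
  assumes n: "n \<ge> 7" and xy: "x < 3 * n" "y < 3 * n" "x \<noteq> y"
  shows "codeg {..<n} (\<lambda>i. set (hex_std_list n i)) x y \<le> 2"
proof (cases "x < n \<and> y < n")
  case False
  then show ?thesis
    using codeg_le_deg[OF finite_lessThan, of n "\<lambda>i. set (hex_std_list n i)" x y]
      codeg_le_deg[OF finite_lessThan, of n "\<lambda>i. set (hex_std_list n i)" y x]
      codeg_commute[of "{..<n}" "\<lambda>i. set (hex_std_list n i)" x y]
      deg_hex_std_list[OF n xy(1)] deg_hex_std_list[OF n xy(2)] by (auto split: if_splits)
next
  case True
  let ?S = "\<lambda>k. {i. i < n \<and> (i + k) mod n = x}"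
  have S: "card (?S 0) \<le> 1" "card (?S 1) \<le> 1" "card (?S 2) \<le> 1"
    using n(1) by (intro card_shift_le_1; simp)+
  let ?B = "{i \<in> {..<n}. x \<in> set (hex_std_list n i) \<and> y \<in> set (hex_std_list n i)}"
  have 1: "i \<in> ?S 0 \<union> ?S 1 \<union> ?S 2" "y = i mod n \<or> y = (i + 1) mod n \<or> y = (i + 2) mod n" if "i \<in> ?B" for i
    using that True by (auto simp: hex_std_list_def)
  have ne: "(i + a) mod n \<noteq> (i + b) mod n" if "a < b" "b < 7" for i a b
  proof
    assume "(i + a) mod n = (i + b) mod n"
    then have "n dvd (i + b) - (i + a)" using mod_eq_dvd_iff_nat[of "i + a" "i + b" n] that by simp
    then show False using that n dvd_imp_le[of n "b - a"] by auto
  qed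
  have "?B \<subseteq> ?S 0 \<union> ?S 1 \<or> ?B \<subseteq> ?S 0 \<union> ?S 2 \<or> ?B \<subseteq> ?S 1 \<union> ?S 2"
  proof (cases "y = (x + 1) mod n")
    case yx: True
    have "i \<notin> ?S 2" if "i \<in> ?B" for i
    proof
      assume "i \<in> ?S 2"
      then have "y = (i + 3) mod n" using yx by (auto simp: mod_simps numeral_3_eq_3)
      then show False using 1(2)[OF that] ne[of 0 3 i] ne[of 1 3 i] ne[of 2 3 i] by auto
    qed
    then show ?thesis using 1(1) by blast
  next
    case yx: False
    show ?thesis
    proof (cases "y = (x + 2) mod n")
      case yx2: True
      have "i \<notin> ?S 1" if "i \<in> ?B" for i
      proof
        assume "i \<in> ?S 1"
        then have "y = (i + 3) mod n" using yx2 by (auto simp: mod_simps numeral_3_eq_3)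
        then show False using 1(2)[OF that] ne[of 0 3 i] ne[of 1 3 i] ne[of 2 3 i] by auto
      qed
      then show ?thesis using 1(1) by blast
    next
      case yx2: False
      have "i \<notin> ?S 0" if "i \<in> ?B" for i
        using 1(2)[OF that] yx yx2 xy(3) by auto
      then show ?thesis using 1(1) by blast
    qed
  qed
  then obtain A B where AB: "?B \<subseteq> A \<union> B" "card A \<le> 1" "card B \<le> 1" "finite A" "finite B"
    using S by (metis (no_types, lifting) finite_nat_set_iff_bounded mem_Collect_eq)
  then have "card ?B \<le> card (A \<union> B)" by (intro card_mono) auto
  then show ?thesis using AB card_Un_le[of A B] unfolding codeg_def by linarith
qed

lemma color_bound_generic:
  assumes n: "n \<ge> 7" and c: "\<And>D. D \<in> hexagons n \<Longrightarrow> \<not> inj_on c D"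
  shows "card (c ` {..<3 * n}) \<le> 5 * n div 2"
proof -
  have "card {..<n} + 2 * card (c ` {..<3 * n}) \<le> 2 * card {..<3 * n}"
  proof (rule deficit_bound_deg_3[where C = "\<lambda>i. set (hex_std_list n i)"])
    fix i assume "i \<in> {..<n}"
    then have "set (hex_std_list n i) \<in> hexagons n"
      unfolding hexagons_eq[OF n] hexagon_list_def by simp
    then show "set (hex_std_list n i) \<subseteq> {..<3 * n} \<and> \<not> inj_on c (set (hex_std_list n i))"
      using c by (auto simp: hexagons_def)
  qed (use deg_hex_std_list[OF n] codeg_hex_std_list[OF n] in \<open>force split: if_splits\<close>)+
  then show ?thesis by simp
qed



section \<open>Incidence lists\<close>

text \<open>
  For each edge the list of the indices of the hexagons through it.  Degrees and codegrees are then lengths of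
  such lists and of their common parts, so that the finite checks below can be evaluated by rewriting.
\<close>

definition incidence_rows :: "nat list list \<Rightarrow> nat \<Rightarrow> nat list list" where
  "incidence_rows cs m = map (\<lambda>x. filter (\<lambda>i. x \<in> set (cs ! i)) [0..<length cs]) [0..<m]"
definition common :: "nat list \<Rightarrow> nat list \<Rightarrow> nat list" where
  "common xs ys = filter (\<lambda>x. x \<in> set ys) xs"
definition degrees_ok where
  "degrees_ok d e rs \<longleftrightarrow> list_all (\<lambda>r. length r \<le> d) rs \<and> sorted_wrt (\<lambda>r s. length (common r s) \<le> e) rs"
text \<open>
  For each edge the list of edges that share no hexagon with it.
\<close>

definition zero_rows :: "nat list list \<Rightarrow> nat list list" where
  "zero_rows rs = map (\<lambda>r. filter (\<lambda>y. common r (rs ! y) = []) [0..<length rs]) rs"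
text \<open>
  The graph on the vertices \<open>0, \<dots>, length zs - 1\<close> has adjacency lists \<open>zs\<close>.  It contains \<open>K\<^bsub>2,2,2\<^esub>\<close> iff the
  common neighbors of some two vertices contain two vertices with two common neighbors among them.
\<close>

definition K22_free where
  "K22_free zs N = sorted_wrt (\<lambda>c d. length (common c d) \<le> 1) (map (\<lambda>z. common N (zs ! z)) N)"
definition K222_free where
  "K222_free zs = sorted_wrt (\<lambda>a b. K22_free zs (common a b)) zs"

text \<open>
  For \<open>n = 8\<close> the classes of interest consist of three edges that hit at least eight hexagons; the sets of
  hexagons hit by such triples are enumerated.  As two edges share at most three hexagons, pairs of edges
  that share fewer than two can be skipped.
\<close>

definition rich_triples_with where
  "rich_triples_with r s ts = filter (\<lambda>h. 8 \<le> length h)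
    (map (\<lambda>t. remdups (common r s @ common r t @ common s t)) ts)"
fun rich_triples_from :: "nat list \<Rightarrow> nat list list \<Rightarrow> nat list list" where
  "rich_triples_from r [] = []"
| "rich_triples_from r (s # ts) = (if length (common r s) < 2 then [] else rich_triples_with r s ts) @ rich_triples_from r ts"
fun rich_triples :: "nat list list \<Rightarrow> nat list list" where
  "rich_triples [] = []"
| "rich_triples (r # rs) = rich_triples_from r rs @ rich_triples rs"

text \<open>
  The hypotheses of \<open>residual_contradiction\<close> on degrees and codegrees, for the family \<open>R\<close> of hexagons that
  are missed.  With codegrees at most three the second one is automatic if \<open>R\<close> has at least seven elements.
\<close>

definition residue_ok where
  "residue_ok rs R \<longleftrightarrow> list_all (\<lambda>r. 3 * length (common r R) < 2 * length R) rs \<and>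
     (7 \<le> length R \<or> sorted_wrt (\<lambda>r s. 2 * length (common (common r s) R) < length R) rs)"
definition residues_ok where
  "residues_ok rs m hs \<longleftrightarrow> list_all (\<lambda>h. list_all (\<lambda>h'.
      residue_ok rs (filter (\<lambda>i. i \<notin> set h \<and> i \<notin> set h') [0..<m])) hs) hs"

abbreviation nth_set :: "nat list list \<Rightarrow> nat \<Rightarrow> nat set" where
  "nth_set cs i \<equiv> set (cs ! i)"

lemma length_incidence_rows [simp]: "length (incidence_rows cs m) = m"
  by (simp add: incidence_rows_def)

lemma incidence_rows_nth:
  assumes "x < m"
  shows "set (incidence_rows cs m ! x) = {i \<in> {..<length cs}. x \<in> nth_set cs i}" "distinct (incidence_rows cs m ! x)"
  using assms by (auto simp: incidence_rows_def)

lemma set_common: "set (common xs ys) = set xs \<inter> set ys"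
  by (auto simp: common_def)
lemma distinct_common: "distinct xs \<Longrightarrow> distinct (common xs ys)"
  by (simp add: common_def)
lemma length_common: "distinct xs \<Longrightarrow> length (common xs ys) = card (set xs \<inter> set ys)"
  using distinct_card[OF distinct_common] by (metis set_common)

lemma deg_incidence_rows: "x < m \<Longrightarrow> deg {..<length cs} (nth_set cs) x = length (incidence_rows cs m ! x)"
  unfolding deg_def using distinct_card[OF incidence_rows_nth(2)] incidence_rows_nth(1) by metis

lemma codeg_incidence_rows:
  assumes "x < m" "y < m"
  shows "codeg {..<length cs} (nth_set cs) x y = length (common (incidence_rows cs m ! x) (incidence_rows cs m ! y))"
proof -
  have "{i \<in> {..<length cs}. x \<in> nth_set cs i \<and> y \<in> nth_set cs i} =
      set (incidence_rows cs m ! x) \<inter> set (incidence_rows cs m ! y)"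
    using assms incidence_rows_nth(1) by auto
  then show ?thesis using length_common[OF incidence_rows_nth(2)[OF assms(1)]] by (simp add: codeg_def)
qed

lemma sorted_wrt_nthD:
  assumes "sorted_wrt P xs" "x < length xs" "y < length xs" "x \<noteq> y"
  shows "P (xs ! x) (xs ! y) \<or> P (xs ! y) (xs ! x)"
  using assms by (metis linorder_neqE_nat sorted_wrt_nth_less)

lemma degrees_okD:
  assumes "degrees_ok d e (incidence_rows cs m)"
  shows "x \<in> {..<m} \<Longrightarrow> deg {..<length cs} (nth_set cs) x \<le> d"
    and "x \<in> {..<m} \<Longrightarrow> y \<in> {..<m} \<Longrightarrow> x \<noteq> y \<Longrightarrow> codeg {..<length cs} (nth_set cs) x y \<le> e"
proof -
  show "x \<in> {..<m} \<Longrightarrow> deg {..<length cs} (nth_set cs) x \<le> d"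
    using assms by (auto simp: degrees_ok_def deg_incidence_rows list_all_length)
  assume xy: "x \<in> {..<m}" "y \<in> {..<m}" "x \<noteq> y"
  then have "length (common (incidence_rows cs m ! x) (incidence_rows cs m ! y)) \<le> e \<or>
      length (common (incidence_rows cs m ! y) (incidence_rows cs m ! x)) \<le> e"
    using assms by (intro sorted_wrt_nthD) (auto simp: degrees_ok_def)
  then show "codeg {..<length cs} (nth_set cs) x y \<le> e"
    using xy codeg_incidence_rows[of x m y cs] codeg_incidence_rows[of y m x cs] codeg_commute[of "{..<length cs}" "nth_set cs" x y]
    by auto
qed

lemma zero_rows_nth:
  assumes "x < m"
  shows "set (zero_rows (incidence_rows cs m) ! x) = {y. y < m \<and> codeg {..<length cs} (nth_set cs) x y = 0}"
    "distinct (zero_rows (incidence_rows cs m) ! x)"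
  using assms by (auto simp: zero_rows_def codeg_incidence_rows)

lemma card_common_zero_le:
  assumes "x < m" "y < m" "x \<noteq> y"
    and "sorted_wrt (\<lambda>a b. length (common a b) \<le> k) (zero_rows (incidence_rows cs m))"
    and S: "\<And>z. z \<in> S \<Longrightarrow> z < m \<and> codeg {..<length cs} (nth_set cs) x z = 0 \<and>
       codeg {..<length cs} (nth_set cs) y z = 0"
  shows "card S \<le> k"
proof -
  let ?Z = "zero_rows (incidence_rows cs m)"
  have len: "length ?Z = m" by (simp add: zero_rows_def)
  have "card (set (?Z ! x) \<inter> set (?Z ! y)) \<le> k"
    using sorted_wrt_nthD[OF assms(4), of x y] assms(1-3) zero_rows_nth(2)
    by (auto simp: len length_common Int_commute)
  moreover have "S \<subseteq> set (?Z ! x) \<inter> set (?Z ! y)"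
    using S assms(1,2) by (auto simp: zero_rows_nth)
  ultimately show ?thesis using card_mono[of "set (?Z ! x) \<inter> set (?Z ! y)" S] by simp
qed

lemma K222_freeD:
  fixes m cs
  defines "cz \<equiv> \<lambda>x y. codeg {..<length cs} (nth_set cs) x y = 0"
  assumes free: "K222_free (zero_rows (incidence_rows cs m))"
    and lt: "{x, x', y, y', z, z'} \<subseteq> {..<m}" and ne: "x \<noteq> x'" "y \<noteq> y'" "z \<noteq> z'"
    and zero: "\<And>a b. a \<in> {x, x'} \<Longrightarrow> b \<in> {y, y', z, z'} \<Longrightarrow> cz a b"
      "\<And>a b. a \<in> {y, y'} \<Longrightarrow> b \<in> {z, z'} \<Longrightarrow> cz a b"
  shows False
proof -
  let ?Z = "zero_rows (incidence_rows cs m)"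
  have len: "length ?Z = m" by (simp add: zero_rows_def)
  have Z: "b \<in> set (?Z ! a) \<longleftrightarrow> b < m \<and> cz a b" if "a < m" for a b
    using that by (simp add: zero_rows_nth cz_def)
  have "K22_free ?Z (common (?Z ! x) (?Z ! x')) \<or> K22_free ?Z (common (?Z ! x') (?Z ! x))"
    using free ne(1) lt len unfolding K222_free_def by (intro sorted_wrt_nthD) auto
  then obtain a a' where a: "{a, a'} = {x, x'}" and K: "K22_free ?Z (common (?Z ! a) (?Z ! a'))"
    by (metis insert_commute)
  define N where "N = common (?Z ! a) (?Z ! a')"
  have lta: "a < m" "a' < m" using a lt by auto
  have N: "distinct N" "{y, y', z, z'} \<subseteq> set N"
    using zero(1)[of a] zero(1)[of a'] a lt lta
    by (auto simp: N_def distinct_common zero_rows_nth(2) set_common Z doubleton_eq_iff)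
  then obtain i j where ij: "i < length N" "j < length N" "N ! i = y" "N ! j = y'"
    by (metis in_set_conv_nth insert_subset)
  then have "i \<noteq> j" using ne(2) by auto
  have c: "length (common (common N (?Z ! b)) (common N (?Z ! b'))) \<ge> 2" if "{b, b'} = {y, y'}" for b b'
  proof -
    have "b < m" "b' < m" using that lt by (auto simp: doubleton_eq_iff)
    have "{z, z'} \<subseteq> set (common N (?Z ! b)) \<inter> set (common N (?Z ! b'))"
      using zero(2)[of b] zero(2)[of b'] that N(2) lt \<open>b < m\<close> \<open>b' < m\<close>
      by (auto simp: set_common Z doubleton_eq_iff)
    then have "card {z, z'} \<le> card (set (common N (?Z ! b)) \<inter> set (common N (?Z ! b')))"
      by (intro card_mono) auto
    then show ?thesis using ne(3) by (simp add: length_common distinct_common N(1))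
  qed
  show False
    using sorted_wrt_nthD[OF K[folded N_def, unfolded K22_free_def], of i j] ij \<open>i \<noteq> j\<close> c[of y y'] c[of y' y]
    by (auto simp: insert_commute)
qed

definition triple_hits where
  "triple_hits r s t = remdups (common r s @ common r t @ common s t)"

lemma rich_triples_fromD:
  assumes "i < j" "j < length ss" "2 \<le> length (common r (ss ! i))"
    "8 \<le> length (triple_hits r (ss ! i) (ss ! j))"
  shows "triple_hits r (ss ! i) (ss ! j) \<in> set (rich_triples_from r ss)"
  using assms
proof (induction ss arbitrary: i j)
  case (Cons s ss)
  obtain j' where j: "j = Suc j'" using Cons.prems(1) by (cases j) auto
  show ?case
  proof (cases i)
    case 0
    then have "triple_hits r s (ss ! j') \<in> set (rich_triples_with r s ss)"
      using Cons.prems j by (auto simp: rich_triples_with_def triple_hits_def)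
    then show ?thesis using Cons.prems 0 j by simp
  next
    case (Suc i')
    then show ?thesis using Cons.IH[of i' j'] Cons.prems j by simp
  qed
qed simp

lemma rich_triplesD:
  assumes "a < b" "b < c" "c < length rs" "2 \<le> length (common (rs ! a) (rs ! b))"
    "8 \<le> length (triple_hits (rs ! a) (rs ! b) (rs ! c))"
  shows "triple_hits (rs ! a) (rs ! b) (rs ! c) \<in> set (rich_triples rs)"
  using assms
proof (induction rs arbitrary: a b c)
  case (Cons r rs)
  obtain b' c' where bc: "b = Suc b'" "c = Suc c'"
    using Cons.prems(1,2) by (cases b; cases c) auto
  show ?case
  proof (cases a)
    case 0
    then show ?thesis using rich_triples_fromD[of b' c' rs r] Cons.prems bc by simp
  next
    case (Suc a')
    then show ?thesis using Cons.IH[of a' b' c'] Cons.prems bc by simp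
  qed
qed simp

lemma card_3_sorted:
  fixes T :: "nat set"
  assumes "card T = 3"
  obtains a b c where "T = {a, b, c}" "a < b" "b < c"
proof -
  have fin: "finite T" using assms card.infinite by fastforce
  let ?l = "sorted_list_of_set T"
  have "length ?l = 3" using assms by simp
  then obtain a b c where l: "?l = [a, b, c]"
    by (metis (no_types, lifting) length_0_conv length_Suc_conv numeral_3_eq_3)
  then have "T = {a, b, c}" using set_sorted_list_of_set[OF fin] by simp
  moreover have "a < b" "b < c" using sorted_sorted_list_of_set[of T] distinct_sorted_list_of_set[of T]
    unfolding l by auto
  ultimately show thesis using that by blast
qed

text \<open>
  The triple hits no more hexagons than the sum of its three codegrees.  Two of them contribute at most six, so
  the third is at least two and the enumeration does not skip the triple.
\<close>

lemma hits_in_rich_triples: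
  assumes T: "T \<subseteq> {..<m}" "card T = 3"
    and codeg: "\<And>x y. x \<in> {..<m} \<Longrightarrow> y \<in> {..<m} \<Longrightarrow> x \<noteq> y \<Longrightarrow> codeg {..<length cs} (nth_set cs) x y \<le> 3"
    and h8: "8 \<le> card (hits {..<length cs} (nth_set cs) T)"
  obtains h where "h \<in> set (rich_triples (incidence_rows cs m))" "set h = hits {..<length cs} (nth_set cs) T"
proof -
  obtain a b c where abc: "T = {a, b, c}" "a < b" "b < c" using card_3_sorted[OF T(2)] .
  then have lt: "a < m" "b < m" "c < m" using T(1) by auto
  let ?r = "\<lambda>x. incidence_rows cs m ! x"
  let ?H = "hits {..<length cs} (nth_set cs) T"
  let ?h = "triple_hits (?r a) (?r b) (?r c)"
  have h: "set ?h = ?H"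
    using abc(2,3) lt by (auto simp: triple_hits_def set_common incidence_rows_nth(1) hits_def abc(1))
  moreover have "distinct ?h" by (simp add: triple_hits_def)
  ultimately have len: "length ?h = card ?H" using distinct_card by metis
  have "length ?h \<le> length (common (?r a) (?r b)) + length (common (?r a) (?r c)) + length (common (?r b) (?r c))"
    unfolding triple_hits_def using length_remdups_leq[of "common (?r a) (?r b) @ common (?r a) (?r c) @ common (?r b) (?r c)"]
    by simp
  moreover have "length (common (?r a) (?r c)) \<le> 3" "length (common (?r b) (?r c)) \<le> 3"
    using codeg[of a c] codeg[of b c] codeg_incidence_rows[of _ m _ cs] lt abc(2,3) by auto
  ultimately have "2 \<le> length (common (?r a) (?r b))" using len h8 by linarith
  then have "?h \<in> set (rich_triples (incidence_rows cs m))"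
    using abc(2,3) lt h8 len by (intro rich_triplesD) simp_all
  then show thesis using that h by blast
qed

lemma residue_okD:
  fixes m cs
  defines "I \<equiv> {..<length cs}" and "C \<equiv> nth_set cs"
  assumes ok: "residue_ok (incidence_rows cs m) R'" and R: "set R' = R" "distinct R'" "R \<subseteq> I"
    and codeg: "\<And>x y. x \<in> {..<m} \<Longrightarrow> y \<in> {..<m} \<Longrightarrow> x \<noteq> y \<Longrightarrow> codeg I C x y \<le> 3"
  shows "x \<in> {..<m} \<Longrightarrow> 3 * deg R C x < 2 * card R"
    and "x \<in> {..<m} \<Longrightarrow> y \<in> {..<m} \<Longrightarrow> x \<noteq> y \<Longrightarrow> 2 * codeg R C x y < card R"
proof -
  have card: "card R = length R'" using R distinct_card by metis
  let ?r = "\<lambda>x. incidence_rows cs m ! x"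
  have deg_R: "deg R C x = length (common (?r x) R')" if "x < m" for x
  proof -
    have "{i \<in> R. x \<in> C i} = set (?r x) \<inter> set R'"
      using that R by (auto simp: incidence_rows_nth(1) I_def C_def)
    then show ?thesis by (simp add: deg_def length_common incidence_rows_nth(2) that)
  qed
  have codeg_R: "codeg R C x y = length (common (common (?r x) (?r y)) R')" if "x < m" "y < m" for x y
  proof -
    have "{i \<in> R. x \<in> C i \<and> y \<in> C i} = set (?r x) \<inter> set (?r y) \<inter> set R'"
      using that R by (auto simp: incidence_rows_nth(1) I_def C_def)
    then show ?thesis
      by (simp add: codeg_def length_common incidence_rows_nth(2) that distinct_common set_common)
  qed
  show "x \<in> {..<m} \<Longrightarrow> 3 * deg R C x < 2 * card R"
    using ok by (auto simp: residue_ok_def list_all_length deg_R card)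
  assume xy: "x \<in> {..<m}" "y \<in> {..<m}" "x \<noteq> y"
  show "2 * codeg R C x y < card R"
  proof (cases "7 \<le> length R'")
    case True
    have "codeg R C x y \<le> codeg I C x y"
      unfolding codeg_def using R(3) by (intro card_mono) (auto simp: I_def)
    then show ?thesis using codeg[OF xy] True card by linarith
  next
    case False
    then have "2 * length (common (common (?r x) (?r y)) R') < length R' \<or>
        2 * length (common (common (?r y) (?r x)) R') < length R'"
      using ok xy by (intro sorted_wrt_nthD) (auto simp: residue_ok_def)
    then show ?thesis
      using xy codeg_R[of x y] codeg_R[of y x] codeg_commute[of R C x y] card by auto
  qed
qed

lemma hexagons_listD:
  assumes "n \<ge> 7" "set cs \<subseteq> set (hexagon_list n)" "i \<in> {..<length cs}"
    and c: "\<And>D. D \<in> hexagons n \<Longrightarrow> \<not> inj_on c D"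
  shows "nth_set cs i \<subseteq> {..<3 * n} \<and> \<not> inj_on c (nth_set cs i)"
proof -
  have "cs ! i \<in> set (hexagon_list n)" using assms(2,3) nth_mem by blast
  then have "nth_set cs i \<in> hexagons n" using hexagons_eq[OF assms(1)] by blast
  then show ?thesis using c by (auto simp: hexagons_def)
qed


section \<open>Upper bounds for n = 8, 10, 18\<close>

text \<open>
  The finite facts about the hexagons of \<open>P\<^bsub>8,3\<^esub>\<close> and \<open>P\<^bsub>10,3\<^esub>\<close>.  For \<open>n = 8\<close> the triples that hit at least
  eight hexagons are the sixteen vertex stars, and the last of the three facts about \<open>n = 8\<close> concerns the hexagons
  avoiding two given vertices.
\<close>

lemma degrees_ok8: "degrees_ok 6 3 (incidence_rows (hexagon_list 8) 24)"
  by code_simp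

lemma zero_rows8: "sorted_wrt (\<lambda>a b. length (common a b) \<le> 3) (zero_rows (incidence_rows (hexagon_list 8) 24))"
  by code_simp

lemma residues_ok8: "residues_ok (incidence_rows (hexagon_list 8) 24) 24 (rich_triples (incidence_rows (hexagon_list 8) 24))"
  by code_simp

lemma degrees_ok10: "degrees_ok 4 2 (incidence_rows (hexagon_list 10) 30)"
  by code_simp

lemma K222_free10: "K222_free (zero_rows (incidence_rows (hexagon_list 10) 30))"
  by code_simp

text \<open>
  The standard hexagons together with two copies of each inner hexagon.  An inner edge lies on one standard and one
  inner hexagon, so its degree is still three.
\<close>

definition doubled18 :: "nat list list" where
  "doubled18 = map (hex_std_list 18) [0..<18] @ map (hex_inner_list 18) [0..<3] @ map (hex_inner_list 18) [0..<3]"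

lemma degrees_ok18: "degrees_ok 3 2 (incidence_rows doubled18 54)"
  by code_simp

lemma color_bound_18:
  assumes c: "\<And>D. D \<in> hexagons 18 \<Longrightarrow> \<not> inj_on c D"
  shows "card (c ` {..<54}) \<le> 42"
proof -
  have len: "length doubled18 = 24" by (simp add: doubled18_def)
  note chk = degrees_ok18
  have sub: "set doubled18 \<subseteq> set (hexagon_list 18)"
  proof -
    have "set (map (hex_inner_list 18) [0..<3]) \<subseteq> set (map (hex_inner_list 18) [0..<18])"
      unfolding set_map by (rule image_mono) simp
    then show ?thesis unfolding doubled18_def hexagon_list_def by (simp del: set_map upt_rec_numeral add: le_supI1 le_supI2)
  qed
  have "card {..<length doubled18} + 2 * card (c ` {..<54}) \<le> 2 * card {..<54 :: nat}"
  proof (rule deficit_bound_deg_3[where C = "nth_set doubled18"])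
    fix i assume "i \<in> {..<length doubled18}"
    then show "nth_set doubled18 i \<subseteq> {..<54} \<and> \<not> inj_on c (nth_set doubled18 i)"
      using hexagons_listD[OF _ sub _ c, of i] by simp
  qed (use degrees_okD[OF chk] in simp_all)
  then show ?thesis by (simp add: len)
qed

text \<open>
  With at most seven units of deficit, \<open>20 \<le> 2 \<cdot> 7 + 2 L\<close> forces \<open>L = 3\<close> large classes and an exact count.  Two edges
  from each of these classes form a \<open>K\<^bsub>2,2,2\<^esub>\<close> in the relation of sharing no hexagon.
\<close>

lemma color_bound_10:
  assumes c: "\<And>D. D \<in> hexagons 10 \<Longrightarrow> \<not> inj_on c D"
  shows "card (c ` {..<30}) \<le> 22"
proof (rule ccontr)
  assume "\<not> ?thesis"
  then have rank: "card {..<30 :: nat} - card (c ` {..<30}) \<le> 7" by simp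
  let ?cs = "hexagon_list 10"
  let ?I = "{..<length ?cs}" let ?C = "nth_set ?cs"
  let ?L = "large_classes c {..<30}"
  have len: "length ?cs = 20" by (simp add: hexagon_list_def)
  have C: "?C i \<subseteq> {..<30} \<and> \<not> inj_on c (?C i)" if "i \<in> ?I" for i
    using hexagons_listD[of 10 ?cs i c] c that by simp
  note ok = degrees_okD[OF degrees_ok10]
  have deg: "deg ?I ?C x \<le> 2 * 2" if "x \<in> {..<30}" for x using ok(1)[OF that] by simp
  have "20 \<le> 2 * (card {..<30 :: nat} - card (c ` {..<30})) + 2 * card ?L"
    using large_classes_bound[of ?I "{..<30}" ?C c 2, OF _ _ C deg ok(2)] by (simp add: len)
  moreover have "2 * card ?L \<le> card {..<30 :: nat} - card (c ` {..<30})"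
    by (rule card_large_classes_le) simp
  ultimately have L: "card ?L = 3" using rank by linarith
  have zero: "codeg ?I ?C x y = 0" if "T \<in> ?L" "T' \<in> ?L" "T \<noteq> T'" "x \<in> T" "y \<in> T'" for T T' x y
    by (rule large_classes_tight(2)[of ?I "{..<30}" ?C c 2, OF _ _ C deg ok(2) _ that])
      (use rank L len in simp_all)
  obtain T1 T2 T3 where T: "?L = {T1, T2, T3}" "T1 \<noteq> T2" "T1 \<noteq> T3" "T2 \<noteq> T3"
    using L card_3_iff by metis
  have two: "\<exists>x y. x \<in> T \<and> y \<in> T \<and> x \<noteq> y \<and> x < 30 \<and> y < 30" if "T \<in> ?L" for T
  proof -
    have "T \<subseteq> {..<30}" "finite T" "card T \<ge> 3"
      using that color_classesD[of T c "{..<30}"] by (auto simp: large_classes_def)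
    then obtain x y where "x \<in> T" "y \<in> T" "x \<noteq> y"
      using card_le_Suc0_iff_eq[of T] by fastforce
    then show ?thesis using \<open>T \<subseteq> {..<30}\<close> by auto
  qed
  obtain x x' where x: "x \<in> T1" "x' \<in> T1" "x \<noteq> x'" "x < 30" "x' < 30" using two[of T1] T by blast
  obtain y y' where y: "y \<in> T2" "y' \<in> T2" "y \<noteq> y'" "y < 30" "y' < 30" using two[of T2] T by blast
  obtain z z' where z: "z \<in> T3" "z' \<in> T3" "z \<noteq> z'" "z < 30" "z' < 30" using two[of T3] T by blast
  have mem: "T1 \<in> ?L" "T2 \<in> ?L" "T3 \<in> ?L" using T(1) by simp_all
  show False
  proof (rule K222_freeD)
    show "K222_free (zero_rows (incidence_rows ?cs 30))" by (rule K222_free10)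
    show "codeg ?I ?C a b = 0" if "a \<in> {x, x'}" "b \<in> {y, y', z, z'}" for a b
    proof -
      have "a \<in> T1" "b \<in> T2 \<or> b \<in> T3" using that x y z by auto
      then show ?thesis using zero[OF mem(1,2) T(2)] zero[OF mem(1,3) T(3)] by metis
    qed
    show "codeg ?I ?C a b = 0" if "a \<in> {y, y'}" "b \<in> {z, z'}" for a b
    proof -
      have "a \<in> T2" "b \<in> T3" using that y z by auto
      then show ?thesis by (rule zero[OF mem(2,3) T(4)])
    qed
  qed (use x y z in auto)
qed

text \<open>
  With at most six units of deficit, \<open>24 \<le> 3 \<cdot> 6 + 3 L\<close> forces \<open>L = 2\<close> or \<open>L = 3\<close> large classes.  For \<open>L = 2\<close> the
  count is exact, and since two edges have at most three common partners with which they share no hexagon,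
  both large classes have size three and hit nine hexagons.  For \<open>L = 3\<close> all large classes have size three and
  together hit all 24 hexagons, each at most nine; so two of them hit at least eight.  In both cases two such
  triples exist, and the hexagons they miss are too many for the remaining two units.
\<close>

lemma color_bound_8:
  assumes c: "\<And>D. D \<in> hexagons 8 \<Longrightarrow> \<not> inj_on c D"
  shows "card (c ` {..<24}) \<le> 17"
proof (rule ccontr)
  assume "\<not> ?thesis"
  then have rank: "card {..<24 :: nat} - card (c ` {..<24}) \<le> 6" by simp
  let ?cs = "hexagon_list 8"
  let ?I = "{..<length ?cs}" let ?C = "nth_set ?cs"
  let ?K = "color_classes c {..<24}" let ?L = "large_classes c {..<24}"
  let ?h = "\<lambda>T. card (hits ?I ?C T)"
  have len: "length ?cs = 24" by (simp add: hexagon_list_def)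
  have C: "?C i \<subseteq> {..<24} \<and> \<not> inj_on c (?C i)" if "i \<in> ?I" for i
    using hexagons_listD[of 8 ?cs i c] c that by simp
  note ok = degrees_okD[OF degrees_ok8]
  have deg: "deg ?I ?C x \<le> 2 * 3" if "x \<in> {..<24}" for x using ok(1)[OF that] by simp
  have "24 \<le> 3 * (card {..<24 :: nat} - card (c ` {..<24})) + 3 * card ?L"
    using large_classes_bound[of ?I "{..<24}" ?C c 3, OF _ _ C deg ok(2)] by (simp add: len)
  moreover have "2 * card ?L \<le> card {..<24 :: nat} - card (c ` {..<24})"
    by (rule card_large_classes_le) simp
  ultimately have L: "card ?L = 2 \<or> card ?L = 3" using rank by linarith
  have TK: "T \<in> ?K" "T \<subseteq> {..<24}" "finite T" "card T \<ge> 3" if "T \<in> ?L" for T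
    using that color_classesD[of T c "{..<24}"] by (auto simp: large_classes_def)
  obtain T1 T2 where T: "T1 \<in> ?K" "T2 \<in> ?K" "T1 \<noteq> T2" "card T1 = 3" "card T2 = 3" "8 \<le> ?h T1" "8 \<le> ?h T2"
    using L
  proof
    assume L2: "card ?L = 2"
    then obtain T1 T2 where T: "?L = {T1, T2}" "T1 \<noteq> T2" by (auto simp: card_2_iff)
    have tight: "3 * (card {..<24 :: nat} - card (c ` {..<24})) + 3 * card ?L \<le> card ?I"
      using rank L2 by (simp add: len)
    have h: "?h T = 3 * card T" if "T \<in> ?L" for T
      using large_classes_tight(1)[of ?I "{..<24}" ?C c 3, OF _ _ C deg ok(2) tight that] by simp
    have zero: "codeg ?I ?C x y = 0" if "T \<in> ?L" "T' \<in> ?L" "T \<noteq> T'" "x \<in> T" "y \<in> T'" for T T' x y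
      using large_classes_tight(2)[of ?I "{..<24}" ?C c 3, OF _ _ C deg ok(2) tight that] by simp
    have le3: "card T' \<le> 3" if T': "T \<in> ?L" "T' \<in> ?L" "T \<noteq> T'" for T T'
    proof -
      obtain x y where xy: "x \<in> T" "y \<in> T" "x \<noteq> y"
        using card_le_Suc0_iff_eq[OF TK(3)[OF T'(1)]] TK(4)[OF T'(1)] by auto
      show ?thesis
      proof (rule card_common_zero_le[of x 24 y 3 ?cs T'])
        show "sorted_wrt (\<lambda>a b. length (common a b) \<le> 3) (zero_rows (incidence_rows ?cs 24))"
          by (rule zero_rows8)
        show "z < 24 \<and> codeg ?I ?C x z = 0 \<and> codeg ?I ?C y z = 0" if "z \<in> T'" for z
          using zero[OF T' xy(1) that] zero[OF T' xy(2) that] TK(2)[OF T'(2)] that by auto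
      qed (use xy TK(2)[OF T'(1)] in auto)
    qed
    have mem: "T1 \<in> ?L" "T2 \<in> ?L" using T(1) by simp_all
    have "card T1 = 3" "card T2 = 3"
      using le3[OF mem(2,1) T(2)[symmetric]] le3[OF mem T(2)] TK(4)[OF mem(1)] TK(4)[OF mem(2)]
      by linarith+
    then show thesis
      using that[OF TK(1)[OF mem(1)] TK(1)[OF mem(2)] T(2)] h[OF mem(1)] h[OF mem(2)] by linarith
  next
    assume L3: "card ?L = 3"
    then obtain T1 T2 T3 where T: "?L = {T1, T2, T3}" "T1 \<noteq> T2" "T1 \<noteq> T3" "T2 \<noteq> T3"
      using card_3_iff by metis
    have fin: "finite ?K" by (simp add: finite_color_classes)
    have sub: "?L \<subseteq> ?K" by (auto simp: large_classes_def)
    have mem: "T1 \<in> ?L" "T2 \<in> ?L" "T3 \<in> ?L" using T(1) by simp_all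
    have split: "(\<Sum>S\<in>?K. f S) = f T1 + f T2 + f T3 + (\<Sum>S\<in>?K - ?L. f S)" for f :: "nat set \<Rightarrow> nat"
      using sum.subset_diff[OF sub fin, of f] T by simp
    have rk: "(card T1 - 1) + (card T2 - 1) + (card T3 - 1) + (\<Sum>S\<in>?K - ?L. card S - 1) \<le> 6"
      using sum_rank_color_classes[of "{..<24}" c] rank unfolding split by simp
    have c3: "card T1 = 3" "card T2 = 3" "card T3 = 3"
      using rk TK(4)[OF mem(1)] TK(4)[OF mem(2)] TK(4)[OF mem(3)] by linarith+
    have "?h S = 0" if "S \<in> ?K - ?L" for S
    proof -
      have "card S - 1 \<le> (\<Sum>S\<in>?K - ?L. card S - 1)"
        by (rule member_le_sum) (use that fin in auto)
      then have "card S \<le> 1" using rk c3 by simp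
      then show ?thesis using hits_card_le_1[of S ?I ?C] color_classesD(2)[of S c "{..<24}"] that by simp
    qed
    then have "24 \<le> ?h T1 + ?h T2 + ?h T3"
      using card_le_sum_hits[of ?I ?K ?I ?C, OF _ fin hits_cover[OF C]] unfolding split by (simp add: len)
    moreover have "?h T \<le> 9" if "T \<in> ?L" "card T = 3" for T
      using card_hits_le_mult[of ?I T ?C "2 * 3"] deg TK(2,3)[OF that(1)] that(2) by auto
    then have "?h T1 \<le> 9" "?h T2 \<le> 9" "?h T3 \<le> 9" using mem c3 by auto
    ultimately consider "8 \<le> ?h T1" "8 \<le> ?h T2" | "8 \<le> ?h T1" "8 \<le> ?h T3" | "8 \<le> ?h T2" "8 \<le> ?h T3"
      by linarith
    then show thesis
      by cases (use that T c3 TK(1)[OF mem(1)] TK(1)[OF mem(2)] TK(1)[OF mem(3)] in auto)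
  qed
  have sub: "T1 \<subseteq> {..<24}" "T2 \<subseteq> {..<24}" using T(1,2) color_classesD(1) by blast+
  obtain h1 where h1: "h1 \<in> set (rich_triples (incidence_rows ?cs 24))" "set h1 = hits ?I ?C T1"
    by (rule hits_in_rich_triples[OF sub(1) T(4) ok(2) T(6)])
  obtain h2 where h2: "h2 \<in> set (rich_triples (incidence_rows ?cs 24))" "set h2 = hits ?I ?C T2"
    by (rule hits_in_rich_triples[OF sub(2) T(5) ok(2) T(7)])
  let ?R' = "filter (\<lambda>i. i \<notin> set h1 \<and> i \<notin> set h2) [0..<24]"
  let ?R = "?I - hits ?I ?C T1 - hits ?I ?C T2"
  have "residue_ok (incidence_rows ?cs 24) ?R'"
    using residues_ok8 h1(1) h2(1) unfolding residues_ok_def list_all_iff by blast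
  note res = residue_okD[OF this _ _ _ ok(2), of ?R]
  have R': "set ?R' = ?R" "distinct ?R'" "?R \<subseteq> ?I" by (auto simp: h1 h2 len)
  show False
    by (rule residual_contradiction[of ?I "{..<24}" ?C c T1 T2 ?R, OF _ _ C rank T(1-5) refl res(1)[OF R'] res(2)[OF R']]) auto
qed


section \<open>Optimal colorings\<close>

text \<open>
  Outer edges with numbers \<open>2k\<close> and \<open>2k + 1\<close> share a color.  For odd \<open>n\<close> the last outer edge joins the last pair.
\<close>

definition pairing :: "nat \<Rightarrow> nat \<Rightarrow> nat" where
  "pairing n e = (if e < n then min (e div 2) (n div 2 - 1) else e)"

lemma card_pairing:
  assumes "n \<ge> 7"
  shows "card (pairing n ` {..<3 * n}) = 5 * n div 2"
proof -
  have "pairing n ` {..<3 * n} = {..<n div 2} \<union> {n..<3 * n}"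
  proof (intro equalityI subsetI)
    fix k assume "k \<in> {..<n div 2} \<union> {n..<3 * n}"
    then show "k \<in> pairing n ` {..<3 * n}"
    proof
      assume "k \<in> {..<n div 2}"
      then have "2 * k < 3 * n" "pairing n (2 * k) = k" by (auto simp: pairing_def)
      then show ?thesis by (metis image_eqI lessThan_iff)
    next
      assume "k \<in> {n..<3 * n}"
      then have "k < 3 * n" "pairing n k = k" by (auto simp: pairing_def)
      then show ?thesis by (metis image_eqI lessThan_iff)
    qed
  qed (use assms in \<open>auto simp: pairing_def\<close>)
  moreover have "card ({..<n div 2} \<union> {n..<3 * n}) = n div 2 + 2 * n"
    by (subst card_Un_disjoint) auto
  ultimately show ?thesis by simp
qed

lemma pairing_not_inj_on_std_list:
  assumes n: "n \<ge> 7" and i: "i < n"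
  shows "\<not> inj_on (pairing n) (set (hex_std_list n i))"
proof -
  have *: "\<not> inj_on (pairing n) (set (hex_std_list n i))"
    if "x \<in> set (hex_std_list n i)" "y \<in> set (hex_std_list n i)" "x \<noteq> y" "pairing n x = pairing n y" for x y
    using that by (auto dest: inj_onD)
  \<comment> \<open>The outer edges of the hexagon are \<open>i\<close>, \<open>i + 1\<close>, \<open>i + 2\<close> modulo \<open>n\<close>.  The last two cases wrap around.\<close>
  consider "i + 2 < n" "even i" | "i + 2 < n" "odd i" | "i + 2 = n" | "i + 1 = n"
    using i by linarith
  then show ?thesis
  proof cases
    case 1
    then obtain k where "i = 2 * k" by (auto elim: evenE)
    then show ?thesis using 1 by (intro *[of i "i + 1"]) (auto simp: hex_std_list_def pairing_def)
  next
    case 2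
    then obtain k where "i = 2 * k + 1" by (auto elim: oddE)
    then show ?thesis using 2 by (intro *[of "i + 1" "i + 2"]) (auto simp: hex_std_list_def pairing_def)
  next
    case 3
    then have "i div 2 \<ge> n div 2 - 1" "(i + 1) div 2 \<ge> n div 2 - 1" by linarith+
    then show ?thesis using 3 by (intro *[of i "i + 1"]) (auto simp: hex_std_list_def pairing_def)
  next
    case 4
    then have "(i + 1) mod n = 0" "(i + 2) mod n = 1" using n by (auto simp: mod_if)
    then show ?thesis using 4 n by (intro *[of 0 1]) (auto simp: hex_std_list_def pairing_def)
  qed
qed

text \<open>
  The outer edges are paired as above; in addition the first two edges \<open>v\<^sub>i v\<^sub>i\<^sub>+\<^sub>3\<close> and \<open>v\<^sub>i\<^sub>+\<^sub>3 v\<^sub>i\<^sub>+\<^sub>6\<close> of each inner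
  hexagon, \<open>i < 3\<close>, share a color.
\<close>

definition coloring18 where "coloring18 e = (if 39 \<le> e then (if e < 42 then e - 3 else e) else pairing 18 e)"
text \<open>
  Three monochromatic vertex stars, at \<open>u\<^sub>0\<close>, \<open>u\<^sub>3\<close>, \<open>u\<^sub>6\<close>, and two pairs of adjacent inner edges, at \<open>v\<^sub>1\<close> and
  \<open>v\<^sub>5\<close>: deficit \<open>3 \<cdot> 2 + 2\<close>.
\<close>

definition coloring10 :: "nat \<Rightarrow> nat" where
  "coloring10 e = (if e \<in> {0, 9, 10} then 0 else if e \<in> {2, 3, 13} then 2 else if e \<in> {5, 6, 16} then 5
     else if e \<in> {21, 28} then 21 else if e \<in> {22, 25} then 22 else e)"
text \<open>
  Three monochromatic vertex stars, at \<open>u\<^sub>0\<close>, \<open>u\<^sub>2\<close>, \<open>u\<^sub>5\<close>, and the pair of inner edges at \<open>v\<^sub>1\<close>: deficit \<open>3 \<cdot> 2 + 1\<close>.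
\<close>

definition coloring8 :: "nat \<Rightarrow> nat" where
  "coloring8 e = (if e \<in> {0, 7, 8} then 0 else if e \<in> {1, 2, 10} then 1 else if e \<in> {4, 5, 13} then 4
     else if e \<in> {17, 22} then 17 else e)"

definition no_rainbow :: "(nat \<Rightarrow> nat) \<Rightarrow> nat list list \<Rightarrow> bool" where
  "no_rainbow c cs \<longleftrightarrow> list_all (\<lambda>xs. distinct xs \<and> \<not> distinct (map c xs)) cs"

lemma no_rainbowD:
  assumes "no_rainbow c (hexagon_list n)" "n \<ge> 7" "D \<in> hexagons n"
  shows "\<not> inj_on c D"
  using assms by (auto simp: no_rainbow_def hexagons_eq list_all_iff distinct_map)

lemma card_colors_list:
  "card (c ` {..<m}) = length (remdups (map c [0..<m]))"
  by (simp add: length_remdups_card_conv lessThan_atLeast0)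

theorem theorem1p5:
  fixes n :: nat
  assumes "n \<ge> 7"
  shows "anti_Ramsey (gen_petersen n 3) (cycle_graph 6) =
    (if n = 8 then 17
     else if n = 10 then 22
     else if n = 18 then 42
     else (5 * n) div 2)" (is "_ = ?v")
proof -
  have fin: "finite (color_numbers (gen_petersen n 3) (cycle_graph 6))"
    by (rule finite_color_numbers) (simp add: edges_gen_petersen_edge_of)
  have upper: "card (c ` {..<3 * n}) \<le> ?v" if "\<And>D. D \<in> hexagons n \<Longrightarrow> \<not> inj_on c D" for c :: "nat \<Rightarrow> nat"
    using that color_bound_8[of c] color_bound_10[of c] color_bound_18[of c] color_bound_generic[OF assms, of c]
    by (cases "n = 8"; cases "n = 10"; cases "n = 18") auto
  have lower: "\<exists>c :: nat \<Rightarrow> nat. card (c ` {..<3 * n}) = ?v \<and> (\<forall>D\<in>hexagons n. \<not> inj_on c D)"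
  proof -
    consider "n = 8" | "n = 10" | "n = 18" | "n \<noteq> 8" "n \<noteq> 10" "n \<noteq> 18" by blast
    then show ?thesis
    proof cases
      case 1
      have "length (remdups (map coloring8 [0..<24])) = 17" "no_rainbow coloring8 (hexagon_list 8)" by code_simp+
      then show ?thesis using no_rainbowD[of coloring8 8] card_colors_list[of coloring8 24]
        by (intro exI[of _ coloring8]) (simp add: 1)
    next
      case 2
      have "length (remdups (map coloring10 [0..<30])) = 22" "no_rainbow coloring10 (hexagon_list 10)" by code_simp+
      then show ?thesis using no_rainbowD[of coloring10 10] card_colors_list[of coloring10 30]
        by (intro exI[of _ coloring10]) (simp add: 2)
    next
      case 3
      have "length (remdups (map coloring18 [0..<54])) = 42" "no_rainbow coloring18 (hexagon_list 18)" by code_simp+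
      then show ?thesis using no_rainbowD[of coloring18 18] card_colors_list[of coloring18 54]
        by (intro exI[of _ coloring18]) (simp add: 3)
    next
      case 4
      then have "\<not> inj_on (pairing n) D" if "D \<in> hexagons n" for D
        using that pairing_not_inj_on_std_list[OF assms] unfolding hexagons_eq[OF assms] hexagon_list_def by auto
      then show ?thesis using 4 card_pairing[OF assms] by (intro exI[of _ "pairing n"]) simp
    qed
  qed
  show ?thesis
    unfolding anti_Ramsey_def
  proof (rule Max_eqI[OF fin])
    show "k \<le> ?v" if "k \<in> color_numbers (gen_petersen n 3) (cycle_graph 6)" for k
      using that upper unfolding color_numbers_gen_petersen[OF assms] by blast
    obtain c :: "nat \<Rightarrow> nat" where c: "card (c ` {..<3 * n}) = ?v" "\<forall>D\<in>hexagons n. \<not> inj_on c D"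
      using lower by blast
    show "?v \<in> color_numbers (gen_petersen n 3) (cycle_graph 6)"
      unfolding color_numbers_gen_petersen[OF assms]
      by (intro CollectI exI[of _ c] conjI c(1)[symmetric] c(2))
  qed
qed

end
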